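(* Let $\Omega\subset\mathbb{R}^N$ be a bounded domain (open connected set). Let $a\in C(\bar\Omega)\cap L^\infty(\Omega)$, and let $K:\Omega\times\Omega\to[0,\infty)$ be such that for every $x\in\Omega$ the map $K(x,\cdot)$ is measurable, for almost every $y\in\Omega$ the map $K(\cdot,y)$ is uniformly continuous, and there exist constants $r_0\ge r_1>0$, $C_0\ge c_0>0$ with $$C_0\,\mathbb{1}_{\Omega\cap B_{r_0}(x)}(y)\ \ge\ K(x,y)\ \ge\ c_0\,\mathbb{1}_{\Omega\cap B_{r_1}(x)}(y)\qquad\text{for all }x,y\in\Omega.$$ Then $$\lambda_p(\mathcal{L}_\Omega+a)=\lambda_p'(\mathcal{L}_\Omega+a)=\lambda_p''(\mathcal{L}_\Omega+a).$$ If in addition $K$ is symmetric ($K(x,y)=K(y,x)$), then $\lambda_p(\mathcal{L}_\Omega+a)=\lambda_v(\mathcal{L}_\Omega+a)$.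
   Context: For $\varphi\in C(\bar\Omega)$, $\mathcal{L}_\Omega[\varphi](x):=\int_\Omega K(x,y)\varphi(y)\,dy$, and $(\mathcal{L}_\Omega+a)\varphi:=\mathcal{L}_\Omega[\varphi]+a\varphi$. $B_r(x)$ is the open ball of radius $r$ centred at $x$ and $\mathbb{1}_A$ the indicator of $A$. The quantities are defined as: $\lambda_p(\mathcal{L}_\Omega+a):=\sup\{\lambda\in\mathbb{R}:\exists\varphi\in C(\bar\Omega),\ \varphi>0,\ \mathcal{L}_\Omega[\varphi]+a\varphi+\lambda\varphi\le0\text{ in }\Omega\}$; $\lambda_p'(\mathcal{L}_\Omega+a):=\inf\{\lambda\in\mathbb{R}:\exists\varphi\in C(\Omega)\cap L^\infty(\Omega),\ \varphi\ge0,\ \varphi\not\equiv0,\ \mathcal{L}_\Omega[\varphi]+(a+\lambda)\varphi\ge0\text{ in }\Omega\}$; $\lambda_p''(\mathcal{L}_\Omega+a):=\inf\{\lambda\in\mathbb{R}:\exists\varphi\in C_c(\Omega),\ \varphi\ge0,\ \varphi\not\equiv0,\ \mathcal{L}_\Omega[\varphi]+(a+\lambda)\varphi\ge0\text{ in }\Omega\}$ ($C_c(\Omega)$ = continuous functions with compact support in $\Omega$); $\lambda_v(\mathcal{L}_\Omega+a):=\inf_{\varphi\in L^2(\Omega),\varphi\not\equiv0}\ -\frac{\langle\mathcal{L}_\Omega[\varphi]+a\varphi,\varphi\rangle}{\|\varphi\|_{L^2(\Omega)}^2}$, where $\langle\cdot,\cdot\rangle$ is the $L^2(\Omega)$ scalar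 product. *)

theory Defs
  imports "HOL-Analysis.Analysis"
begin

definition nlop :: "('a::euclidean_space \<Rightarrow> 'a \<Rightarrow> real) \<Rightarrow> 'a set \<Rightarrow> ('a \<Rightarrow> real) \<Rightarrow> 'a \<Rightarrow> real" where
  "nlop K \<Omega> \<phi> x = integral\<^sup>L (lebesgue_on \<Omega>) (\<lambda>y. K x y * \<phi> y)"

definition lambda_p :: "('a::euclidean_space \<Rightarrow> 'a \<Rightarrow> real) \<Rightarrow> 'a set \<Rightarrow> ('a \<Rightarrow> real) \<Rightarrow> real" where
  "lambda_p K \<Omega> a = Sup {l. \<exists>\<phi>. continuous_on (closure \<Omega>) \<phi> \<and> (\<forall>x\<in>closure \<Omega>. \<phi> x > 0) \<and>
      (\<forall>x\<in>\<Omega>. nlop K \<Omega> \<phi> x + a x * \<phi> x + l * \<phi> x \<le> 0)}"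

definition lambda_p' :: "('a::euclidean_space \<Rightarrow> 'a \<Rightarrow> real) \<Rightarrow> 'a set \<Rightarrow> ('a \<Rightarrow> real) \<Rightarrow> real" where
  "lambda_p' K \<Omega> a = Inf {l. \<exists>\<phi>. continuous_on \<Omega> \<phi> \<and> bounded (\<phi> ` \<Omega>) \<and>
      (\<forall>x\<in>\<Omega>. \<phi> x \<ge> 0) \<and> (\<exists>x\<in>\<Omega>. \<phi> x \<noteq> 0) \<and>
      (\<forall>x\<in>\<Omega>. nlop K \<Omega> \<phi> x + (a x + l) * \<phi> x \<ge> 0)}"

definition lambda_p'' :: "('a::euclidean_space \<Rightarrow> 'a \<Rightarrow> real) \<Rightarrow> 'a set \<Rightarrow> ('a \<Rightarrow> real) \<Rightarrow> real" where
  "lambda_p'' K \<Omega> a = Inf {l. \<exists>\<phi> C. continuous_on \<Omega> \<phi> \<and> compact C \<and> C \<subseteq> \<Omega> \<and>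
      (\<forall>x\<in>\<Omega> - C. \<phi> x = 0) \<and>
      (\<forall>x\<in>\<Omega>. \<phi> x \<ge> 0) \<and> (\<exists>x\<in>\<Omega>. \<phi> x \<noteq> 0) \<and>
      (\<forall>x\<in>\<Omega>. nlop K \<Omega> \<phi> x + (a x + l) * \<phi> x \<ge> 0)}"

definition lambda_v :: "('a::euclidean_space \<Rightarrow> 'a \<Rightarrow> real) \<Rightarrow> 'a set \<Rightarrow> ('a \<Rightarrow> real) \<Rightarrow> real" where
  "lambda_v K \<Omega> a = Inf {q. \<exists>\<phi>. \<phi> \<in> borel_measurable (lebesgue_on \<Omega>) \<and>
      integrable (lebesgue_on \<Omega>) (\<lambda>x. (\<phi> x)\<^sup>2) \<and>
      integral\<^sup>L (lebesgue_on \<Omega>) (\<lambda>x. (\<phi> x)\<^sup>2) \<noteq> 0 \<and>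
      q = - integral\<^sup>L (lebesgue_on \<Omega>) (\<lambda>x. (nlop K \<Omega> \<phi> x + a x * \<phi> x) * \<phi> x)
            / integral\<^sup>L (lebesgue_on \<Omega>) (\<lambda>x. (\<phi> x)\<^sup>2)}"

end

theory Submission
  imports Defs
begin

text \<open>A subsolution cannot touch a supersolution with a larger parameter from below, so every
  supersolution parameter lies below every subsolution parameter. Conversely, fix a parameter \<open>l\<close>
  and put \<open>b = - a - l\<close>. If \<open>b\<close> gets small or negative somewhere, a bump function is a subsolution
  for a slightly larger parameter. Otherwise consider the positive operator \<open>T f = L f / b\<close>: if
  \<open>T\<^sup>n 1 \<le> 1\<close> for some \<open>n \<ge> 1\<close>, then \<open>\<Sum>k<n. T\<^sup>k 1\<close> is a supersolution; if not, these sums have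
  unbounded mass, and applying a power of \<open>T\<close> that spreads mass over the whole domain turns them
  into almost-subsolutions bounded away from zero, which may be cut off near the boundary. For a
  symmetric kernel, compactly supported subsolutions are test functions for the Rayleigh quotient,
  which in turn is bounded below by means of supersolutions.\<close>

section \<open>Nonlocal operators with bounded kernels\<close>

text \<open>The obstacle is lack of compactness: multiplication by \<open>a\<close> does not smooth,
  and the operator may have no positive eigenfunction at all, so the four numbers cannot be compared
  through a common one. What replaces it is an alternative with slack: for all \<open>l\<close> and
  \<open>e > 0\<close>, either \<open>l\<close> admits a supersolution or \<open>l + e\<close>
  admits a compactly supported subsolution. Together with the comparison of parameters this
  determines every infimum at once, without passing to a limit of sub- or supersolutions. The slack
  also gives \<open>b \<ge> e\<close> in the main case, so that division by \<open>b\<close> is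
  harmless and \<open>T\<close> keeps the smoothing of \<open>L\<close>, from integrable to
  uniformly continuous functions. Iterating on the connected domain even turns a lower bound on mass
  into a pointwise lower bound, which is why it suffices to make the mass of the partial sums
  large.\<close>

locale bounded_kernel =
  fixes \<Omega> :: "'a::euclidean_space set"
    and K :: "'a \<Rightarrow> 'a \<Rightarrow> real"
    and C :: real
  assumes open_dom: "open \<Omega>"
    and bounded_dom: "bounded \<Omega>"
    and nonempty_dom: "\<Omega> \<noteq> {}"
    and kernel_nonneg: "\<And>x y. x \<in> \<Omega> \<Longrightarrow> y \<in> \<Omega> \<Longrightarrow> 0 \<le> K x y"
    and kernel_le: "\<And>x y. x \<in> \<Omega> \<Longrightarrow> y \<in> \<Omega> \<Longrightarrow> K x y \<le> C"
    and kernel_measurable: "\<And>x. x \<in> \<Omega> \<Longrightarrow> K x \<in> borel_measurable (lebesgue_on \<Omega>)"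
    and kernel_uniformly_continuous:
      "AE y in lebesgue_on \<Omega>. uniformly_continuous_on \<Omega> (\<lambda>x. K x y)"
    and bound_pos: "0 < C"
begin

abbreviation "M \<equiv> lebesgue_on \<Omega>"
abbreviation "L \<equiv> nlop K \<Omega>"

section \<open>The domain as a finite measure space, and uniformly continuous functions on
  it\<close>

lemma dom_lmeasurable: "\<Omega> \<in> lmeasurable"
  using bounded_dom open_dom by (rule lmeasurable_open)

lemma dom_sets [measurable]: "\<Omega> \<in> sets lebesgue"
  using dom_lmeasurable by (rule fmeasurableD)

lemma space_M [simp]: "space M = \<Omega>"
  by (simp add: space_restrict_space)

sublocale finite_measure M
  using dom_lmeasurable by (rule finite_measure_lebesgue_on)

text \<open>Supersolutions must be continuous on the closure, whereas \<open>L f\<close> is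
  controlled on \<Omega> only. Uniform continuity on the bounded set \<Omega> is the intrinsic form
  of the same condition, and it is preserved by the operators below.\<close>

lemma uniformly_continuous_iff_extension:
  fixes f :: "'a \<Rightarrow> real"
  shows "uniformly_continuous_on \<Omega> f \<longleftrightarrow>
    (\<exists>g. continuous_on (closure \<Omega>) g \<and> (\<forall>x\<in>\<Omega>. g x = f x))"
proof
  assume "uniformly_continuous_on \<Omega> f"
  then show "\<exists>g. continuous_on (closure \<Omega>) g \<and> (\<forall>x\<in>\<Omega>. g x = f x)"
  proof (rule uniformly_continuous_on_extension_on_closure)
    fix g
    assume g: "uniformly_continuous_on (closure \<Omega>) g" "\<And>x. x \<in> \<Omega> \<Longrightarrow> f x = g x"
    then have "continuous_on (closure \<Omega>) g"
      using uniformly_continuous_imp_continuous by auto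
    then show ?thesis
      using g(2) by auto
  qed
next
  assume "\<exists>g. continuous_on (closure \<Omega>) g \<and> (\<forall>x\<in>\<Omega>. g x = f x)"
  then obtain g where g: "continuous_on (closure \<Omega>) g" "\<forall>x\<in>\<Omega>. g x = f x"
    by blast
  have "compact (closure \<Omega>)"
    using bounded_dom by simp
  then have uc: "uniformly_continuous_on (closure \<Omega>) g"
    by (rule compact_uniformly_continuous[OF g(1)])
  show "uniformly_continuous_on \<Omega> f"
    unfolding uniformly_continuous_on_def
  proof (intro allI impI)
    fix e :: real
    assume "0 < e"
    then obtain d where d: "0 < d"
      "\<forall>x\<in>closure \<Omega>. \<forall>x'\<in>closure \<Omega>. dist x' x < d \<longrightarrow> dist (g x') (g x) < e"
      using uc unfolding uniformly_continuous_on_def by meson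
    have "dist (f x') (f x) < e" if "x \<in> \<Omega>" "x' \<in> \<Omega>" "dist x' x < d" for x x'
      using d(2) g(2) that closure_subset[of \<Omega>] by (metis subsetD)
    with d(1) show "\<exists>d>0. \<forall>x\<in>\<Omega>. \<forall>x'\<in>\<Omega>. dist x' x < d \<longrightarrow> dist (f x') (f x) < e"
      by blast
  qed
qed

lemma uniformly_continuous_divide:
  fixes f g :: "'a \<Rightarrow> real"
  assumes "uniformly_continuous_on \<Omega> f" "uniformly_continuous_on \<Omega> g" "0 < d" "\<And>x. x \<in> \<Omega> \<Longrightarrow> d \<le> g x"
  shows "uniformly_continuous_on \<Omega> (\<lambda>x. f x / g x)"
proof -
  obtain f' g' where f': "continuous_on (closure \<Omega>) f'" "\<forall>x\<in>\<Omega>. f' x = f x"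
    and g': "continuous_on (closure \<Omega>) g'" "\<forall>x\<in>\<Omega>. g' x = g x"
    using assms(1,2) uniformly_continuous_iff_extension by metis
  have "d \<le> g' x" if "x \<in> closure \<Omega>" for x
    using continuous_ge_on_closure[OF g'(1) that] g'(2) assms(4) by simp
  then have "continuous_on (closure \<Omega>) (\<lambda>x. f' x / g' x)"
    using assms(3) by (intro continuous_on_divide f' g') force
  then show ?thesis
    using f'(2) g'(2) unfolding uniformly_continuous_iff_extension
    by (intro exI conjI) auto
qed

lemma uniformly_continuous_bounded:
  fixes f :: "'a \<Rightarrow> real"
  assumes "uniformly_continuous_on \<Omega> f"
  shows "\<exists>B>0. \<forall>x\<in>\<Omega>. \<bar>f x\<bar> \<le> B"
proof -
  have "bounded (f ` \<Omega>)"
    using assms bounded_dom by (rule bounded_uniformly_continuous_image)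
  then show ?thesis
    unfolding bounded_pos by simp
qed

lemma bounded_measurable_integrable:
  fixes f :: "'a \<Rightarrow> real"
  assumes "f \<in> borel_measurable M" "\<And>x. x \<in> \<Omega> \<Longrightarrow> \<bar>f x\<bar> \<le> B"
  shows "integrable M f"
  by (rule integrable_const_bound[where B = B]) (use assms in auto)

lemma continuous_measurable:
  fixes f :: "'a \<Rightarrow> real"
  shows "continuous_on \<Omega> f \<Longrightarrow> f \<in> borel_measurable M"
  using continuous_imp_measurable_on_sets_lebesgue dom_sets by blast

lemma uniformly_continuous_integrable:
  fixes f :: "'a \<Rightarrow> real"
  assumes "uniformly_continuous_on \<Omega> f"
  shows "integrable M f"
proof -
  obtain B where B: "\<forall>x\<in>\<Omega>. \<bar>f x\<bar> \<le> B"
    using uniformly_continuous_bounded[OF assms] by blast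
  show ?thesis
  proof (rule bounded_measurable_integrable)
    show "f \<in> borel_measurable M"
      using continuous_measurable uniformly_continuous_imp_continuous[OF assms] .
    show "\<bar>f x\<bar> \<le> B" if "x \<in> \<Omega>" for x
      using B that by blast
  qed
qed

lemma kernel_mult_integrable:
  assumes "x \<in> \<Omega>" "integrable M f"
  shows "integrable M (\<lambda>y. K x y * f y)"
proof (rule Bochner_Integration.integrable_bound)
  show "integrable M (\<lambda>y. C * \<bar>f y\<bar>)"
    using assms(2) by simp
  show "(\<lambda>y. K x y * f y) \<in> borel_measurable M"
    using kernel_measurable[OF assms(1)] assms(2) by simp
  show "AE y in M. norm (K x y * f y) \<le> norm (C * \<bar>f y\<bar>)"
    using kernel_nonneg[OF assms(1)] kernel_le[OF assms(1)] bound_pos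
    by (intro AE_I2) (auto simp: abs_mult intro!: mult_right_mono)
qed

section \<open>Order, linearity and continuity properties of the operator\<close>

lemma nlop_cong:
  assumes "\<And>y. y \<in> \<Omega> \<Longrightarrow> f y = g y"
  shows "L f x = L g x"
  unfolding nlop_def using assms by (intro Bochner_Integration.integral_cong) auto

lemma nlop_mono:
  assumes "x \<in> \<Omega>" "integrable M f" "integrable M g" "\<And>y. y \<in> \<Omega> \<Longrightarrow> f y \<le> g y"
  shows "L f x \<le> L g x"
  unfolding nlop_def using assms kernel_nonneg
  by (intro integral_mono kernel_mult_integrable) (auto intro: mult_left_mono)

lemma nlop_nonneg:
  assumes "x \<in> \<Omega>" "\<And>y. y \<in> \<Omega> \<Longrightarrow> 0 \<le> f y"
  shows "0 \<le> L f x"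
  unfolding nlop_def using assms kernel_nonneg
  by (intro Bochner_Integration.integral_nonneg) auto

lemma nlop_diff:
  assumes "x \<in> \<Omega>" "integrable M f" "integrable M g"
  shows "L (\<lambda>y. f y - g y) x = L f x - L g x"
  unfolding nlop_def using assms by (simp add: right_diff_distrib kernel_mult_integrable)

lemma nlop_sum:
  assumes "x \<in> \<Omega>" "\<And>i. i \<in> I \<Longrightarrow> integrable M (f i)"
  shows "L (\<lambda>y. \<Sum>i\<in>I. f i y) x = (\<Sum>i\<in>I. L (f i) x)"
  unfolding nlop_def using assms
  by (simp add: sum_distrib_left kernel_mult_integrable Bochner_Integration.integral_sum)

lemma nlop_cmult: "L (\<lambda>y. c * f y) x = c * L f x"
  unfolding nlop_def by (simp add: mult.left_commute[of _ c])

lemma nlop_abs_le: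
  assumes "x \<in> \<Omega>" "integrable M f"
  shows "\<bar>L f x\<bar> \<le> C * (\<integral>y. \<bar>f y\<bar> \<partial>M)"
proof -
  have "\<bar>L f x\<bar> \<le> (\<integral>y. \<bar>K x y * f y\<bar> \<partial>M)"
    unfolding nlop_def by (rule integral_abs_bound)
  also have "\<dots> \<le> (\<integral>y. C * \<bar>f y\<bar> \<partial>M)"
    using assms kernel_nonneg kernel_le
    by (intro integral_mono integrable_abs kernel_mult_integrable integrable_mult_right)
      (simp_all add: abs_mult mult_right_mono)
  finally show ?thesis by simp
qed

text \<open>The modulus of continuity of \<open>K(., y)\<close> may degenerate as \<open>y\<close>
  varies, so there is no direct estimate. Along two sequences that approach each other the
  integrands converge to zero almost everywhere and are dominated by
  \<open>2 * C * \<bar>f y\<bar>\<close>.\<close>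

lemma nlop_uniformly_continuous:
  assumes f: "integrable M f"
  shows "uniformly_continuous_on \<Omega> (L f)"
  unfolding uniformly_continuous_on_sequentially
proof (intro allI impI, elim conjE)
  fix X Y :: "nat \<Rightarrow> 'a"
  assume X: "\<forall>n. X n \<in> \<Omega>" and Y: "\<forall>n. Y n \<in> \<Omega>" and XY: "(\<lambda>n. dist (X n) (Y n)) \<longlonglongrightarrow> 0"
  have "(\<lambda>n. \<integral>y. K (X n) y * f y - K (Y n) y * f y \<partial>M) \<longlonglongrightarrow> (\<integral>y. 0 \<partial>M)"
  proof (rule integral_dominated_convergence)
    show "(\<lambda>y. K (X n) y * f y - K (Y n) y * f y) \<in> borel_measurable M" for n
      using X Y f kernel_mult_integrable by simp
    show "integrable M (\<lambda>y. 2 * C * \<bar>f y\<bar>)"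
      using f by simp
    show "AE y in M. (\<lambda>n. K (X n) y * f y - K (Y n) y * f y) \<longlonglongrightarrow> 0"
      using kernel_uniformly_continuous
    proof eventually_elim
      fix y assume "uniformly_continuous_on \<Omega> (\<lambda>x. K x y)"
      then have "(\<lambda>n. dist (K (X n) y) (K (Y n) y)) \<longlonglongrightarrow> 0"
        using X Y XY unfolding uniformly_continuous_on_sequentially by blast
      then have "(\<lambda>n. K (X n) y - K (Y n) y) \<longlonglongrightarrow> 0"
        unfolding dist_norm by (rule tendsto_norm_zero_cancel)
      then have "(\<lambda>n. (K (X n) y - K (Y n) y) * f y) \<longlonglongrightarrow> 0"
        by (rule tendsto_mult_left_zero)
      then show "(\<lambda>n. K (X n) y * f y - K (Y n) y * f y) \<longlonglongrightarrow> 0"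
        by (simp add: left_diff_distrib)
    qed
    show "AE y in M. norm (K (X n) y * f y - K (Y n) y * f y) \<le> 2 * C * \<bar>f y\<bar>" for n
    proof (rule AE_I2)
      fix y assume "y \<in> space M"
      then have "\<bar>K (X n) y - K (Y n) y\<bar> \<le> 2 * C"
        using kernel_nonneg[of "X n" y] kernel_le[of "X n" y] kernel_nonneg[of "Y n" y]
          kernel_le[of "Y n" y] X Y by simp
      then show "norm (K (X n) y * f y - K (Y n) y * f y) \<le> 2 * C * \<bar>f y\<bar>"
        by (simp add: left_diff_distrib[symmetric] abs_mult mult_right_mono)
    qed
  qed simp
  moreover have "(\<integral>y. K (X n) y * f y - K (Y n) y * f y \<partial>M) = L f (X n) - L f (Y n)" for n
    unfolding nlop_def using X Y f kernel_mult_integrable by simp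
  ultimately have "(\<lambda>n. L f (X n) - L f (Y n)) \<longlonglongrightarrow> 0"
    by simp
  then show "(\<lambda>n. dist (L f (X n)) (L f (Y n))) \<longlonglongrightarrow> 0"
    unfolding dist_norm by (rule tendsto_norm_zero)
qed

section \<open>Comparison of parameters and cut-off near the boundary\<close>

lemma measure_ball_inter_dom_pos:
  assumes "p \<in> closure \<Omega>" "0 < e"
  shows "0 < measure M (\<Omega> \<inter> ball p e)"
proof -
  have o: "open (\<Omega> \<inter> ball p e)"
    using open_dom by blast
  obtain y where "y \<in> \<Omega>" "dist y p < e"
    using assms closure_approachable by blast
  then have "y \<in> \<Omega> \<inter> ball p e"
    by (simp add: dist_commute)
  then have "\<not> negligible (\<Omega> \<inter> ball p e)"
    using o open_not_negligible by blast
  moreover have l: "\<Omega> \<inter> ball p e \<in> lmeasurable"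
    using o bounded_dom by (intro lmeasurable_open) auto
  ultimately have "measure lebesgue (\<Omega> \<inter> ball p e) \<noteq> 0"
    using negligible_iff_measure0 by blast
  then have "0 < measure lebesgue (\<Omega> \<inter> ball p e)"
    using zero_less_measure_iff by blast
  then show ?thesis
    by (simp add: measure_restrict_space)
qed

lemma open_inter_ball_sets: "\<Omega> \<inter> ball p e \<in> sets M"
  using open_dom by (simp add: sets_restrict_space_iff)

lemma continuous_pos_lower_bound:
  fixes g :: "'a \<Rightarrow> real"
  assumes "continuous_on (closure \<Omega>) g" "\<forall>x\<in>closure \<Omega>. 0 < g x"
  shows "\<exists>m>0. \<forall>x\<in>\<Omega>. m \<le> g x"
proof -
  have "compact (closure \<Omega>)" "closure \<Omega> \<noteq> {}"
    using bounded_dom nonempty_dom by auto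
  then obtain z where z: "z \<in> closure \<Omega>" "\<forall>y\<in>closure \<Omega>. g z \<le> g y"
    using continuous_attains_inf assms(1) by blast
  show ?thesis
  proof (intro exI conjI ballI)
    show "0 < g z"
      using assms(2) z(1) by blast
    show "g z \<le> g x" if "x \<in> \<Omega>" for x
      using that z(2) closure_subset by blast
  qed
qed

text \<open>Scale the supersolution until it touches the subsolution from above, up to a small error,
  and evaluate both inequalities at an almost-contact point.\<close>

lemma supersolution_le_subsolution:
  assumes a: "uniformly_continuous_on \<Omega> a"
    and g: "continuous_on (closure \<Omega>) g" "\<forall>x\<in>closure \<Omega>. 0 < g x"
      "\<forall>x\<in>\<Omega>. L g x + a x * g x + l * g x \<le> 0"
    and f: "continuous_on \<Omega> f" "bounded (f ` \<Omega>)" "\<forall>x\<in>\<Omega>. 0 \<le> f x" "\<exists>x\<in>\<Omega>. f x \<noteq> 0"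
      "\<forall>x\<in>\<Omega>. 0 \<le> L f x + (a x + m) * f x"
  shows "l \<le> m"
proof (rule ccontr)
  assume "\<not> l \<le> m"
  then have lm: "0 < l - m" by simp
  obtain \<delta> where \<delta>: "0 < \<delta>" "\<And>x. x \<in> \<Omega> \<Longrightarrow> \<delta> \<le> g x"
    using continuous_pos_lower_bound[OF g(1,2)] by metis
  have g_pos: "0 < g x" if "x \<in> \<Omega>" for x
    using \<delta>(1) \<delta>(2)[OF that] by simp
  have g_uc: "uniformly_continuous_on \<Omega> g"
    using g(1) uniformly_continuous_iff_extension by blast
  obtain G where G: "0 < G" "\<forall>x\<in>\<Omega>. \<bar>g x\<bar> \<le> G"
    using uniformly_continuous_bounded[OF g_uc] by blast
  have "uniformly_continuous_on \<Omega> (\<lambda>x. a x + l)"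
    using a by (intro uniformly_continuous_on_add uniformly_continuous_on_const)
  then obtain Q where Q: "0 < Q" "\<forall>x\<in>\<Omega>. \<bar>a x + l\<bar> \<le> Q"
    using uniformly_continuous_bounded by blast
  obtain F where F: "0 < F" "\<And>x. x \<in> \<Omega> \<Longrightarrow> \<bar>f x\<bar> \<le> F"
    using f(2) unfolding bounded_pos by auto
  have f_int: "integrable M f"
    using continuous_measurable[OF f(1)] F(2) by (rule bounded_measurable_integrable)
  \<comment> \<open>Nothing is known about \<open>f\<close> near the boundary beyond boundedness, so
    this supremum need not be attained; hence the near-maximizer and the error
    \<open>e\<close>.\<close>
  define \<gamma> where "\<gamma> = (SUP x\<in>\<Omega>. f x / g x)"
  have "f x / g x \<le> F / \<delta>" if "x \<in> \<Omega>" for x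
    using that F \<delta> f(3) by (intro frac_le) fastforce+
  then have bdd: "bdd_above ((\<lambda>x. f x / g x) ` \<Omega>)"
    by (intro bdd_aboveI2)
  have \<gamma>_ge: "f x / g x \<le> \<gamma>" if "x \<in> \<Omega>" for x
    unfolding \<gamma>_def using that bdd by (rule cSUP_upper)
  obtain x1 where x1: "x1 \<in> \<Omega>" "f x1 \<noteq> 0"
    using f(4) by blast
  then have "0 < f x1 / g x1"
    using f(3) g_pos by (simp add: less_le)
  then have \<gamma>: "0 < \<gamma>"
    using \<gamma>_ge[OF x1(1)] by simp
  \<comment> \<open>The first bound keeps \<open>f x \<ge> \<gamma> / 2 * \<delta>\<close> at the
    near-contact point. The second makes the remainder \<open>Q * (e * G)\<close> at most half of
    the resulting lower bound for \<open>(l - m) * f x\<close>.\<close>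
  define e where "e = min (\<gamma> / 2) ((l - m) * (\<gamma> / 2 * \<delta>) / (2 * (Q * G)))"
  have e: "0 < e"
    unfolding e_def using \<gamma> lm \<delta>(1) Q(1) G(1) by simp
  have "\<gamma> - e < (SUP x\<in>\<Omega>. f x / g x)"
    using e unfolding \<gamma>_def by simp
  then obtain x where x: "x \<in> \<Omega>" "\<gamma> - e < f x / g x"
    using less_cSUP_iff[OF nonempty_dom bdd] by blast
  define w where "w y = \<gamma> * g y - f y" for y
  have w_nonneg: "0 \<le> w y" if "y \<in> \<Omega>" for y
    using \<gamma>_ge[OF that] g_pos[OF that] unfolding w_def by (simp add: pos_divide_le_eq)
  have fx: "(\<gamma> - e) * g x < f x"
    using x g_pos by (simp add: pos_less_divide_eq)
  have "w x \<le> e * g x"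
    using fx unfolding w_def by (simp add: algebra_simps)
  also have "\<dots> \<le> e * G"
    using G x(1) e by (intro mult_left_mono) fastforce+
  finally have w_le: "w x \<le> e * G" .
  have "\<gamma> / 2 * \<delta> \<le> (\<gamma> - e) * g x"
    using \<delta> x(1) \<gamma> unfolding e_def by (intro mult_mono) auto
  then have f_ge: "\<gamma> / 2 * \<delta> \<le> f x"
    using fx by simp
  have "0 \<le> L w x"
    using x(1) w_nonneg by (rule nlop_nonneg)
  also have "L w x = \<gamma> * L g x - L f x"
    unfolding w_def
    using nlop_diff[OF x(1) _ f_int, of "\<lambda>y. \<gamma> * g y"] uniformly_continuous_integrable[OF g_uc]
    by (simp add: nlop_cmult)
  also have "\<dots> \<le> \<gamma> * (- (a x * g x + l * g x)) - (- ((a x + m) * f x))"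
    using g(3) f(5) x(1) \<gamma> by (intro diff_mono mult_left_mono) fastforce+
  also have "\<dots> = - (a x + l) * w x - (l - m) * f x"
    unfolding w_def by (simp add: algebra_simps)
  finally have "(l - m) * f x \<le> - (a x + l) * w x"
    by simp
  also have "\<dots> \<le> Q * w x"
    using Q x(1) w_nonneg[OF x(1)] by (intro mult_right_mono) fastforce+
  also have "\<dots> \<le> Q * (e * G)"
    using w_le Q(1) by simp
  also have "\<dots> = e * (Q * G)"
    by simp
  also have "\<dots> \<le> (l - m) * (\<gamma> / 2 * \<delta>) / (2 * (Q * G)) * (Q * G)"
    unfolding e_def using Q(1) G(1) by (intro mult_right_mono) auto
  also have "\<dots> = (l - m) * (\<gamma> / 2 * \<delta>) / 2"
    using Q(1) G(1) by simp
  also have "\<dots> < (l - m) * (\<gamma> / 2 * \<delta>)"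
    using lm \<gamma> \<delta>(1) by simp
  also have "\<dots> \<le> (l - m) * f x"
    using f_ge lm by simp
  finally show False by simp
qed

text \<open>Multiplying \<open>w\<close> by a cut-off changes \<open>L w\<close> by at most
  \<open>C\<close> times the \<open>L^1\<close> norm of what is removed, uniformly in
  \<open>x\<close>. Since \<open>w \<ge> m > 0\<close>, once this is at most \<open>s * m\<close> it
  is absorbed by the loss \<open>s * w\<close>.\<close>

lemma exists_compactly_supported_subsolution:
  assumes w: "uniformly_continuous_on \<Omega> w" and m: "0 < m" "\<forall>x\<in>\<Omega>. m \<le> w x"
    and sub: "\<forall>x\<in>\<Omega>. \<beta> x * w x \<le> L w x" and s: "0 < s"
  shows "\<exists>\<psi> S. continuous_on \<Omega> \<psi> \<and> compact S \<and> S \<subseteq> \<Omega> \<and> (\<forall>x\<in>\<Omega> - S. \<psi> x = 0) \<and>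
    (\<forall>x\<in>\<Omega>. 0 \<le> \<psi> x) \<and> (\<exists>x\<in>\<Omega>. \<psi> x \<noteq> 0) \<and> (\<forall>x\<in>\<Omega>. (\<beta> x - s) * \<psi> x \<le> L \<psi> x)"
proof -
  define \<rho> where "\<rho> x = infdist x (- \<Omega>)" for x
  \<comment> \<open>For \<open>n > 0\<close> the cut-off vanishes where \<rho> is at most
    \<open>1/n\<close> and equals 1 where \<rho> is at least \<open>2/n\<close>, so its support
    stays away from the boundary.\<close>
  define \<zeta> where "\<zeta> n x = min 1 (max 0 (real n * \<rho> x - 1))" for n :: nat and x
  \<comment> \<open>The distance to the empty set is 0 by convention, which would make \<rho> vanish
    identically.\<close>
  have ne: "- \<Omega> \<noteq> {}"
    using bounded_dom not_bounded_UNIV by (metis Compl_empty_eq double_complement)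
  have \<rho>_pos: "0 < \<rho> x \<longleftrightarrow> x \<in> \<Omega>" for x
    using in_closed_iff_infdist_zero[of "- \<Omega>" x] open_dom ne infdist_nonneg[of x "- \<Omega>"]
    unfolding \<rho>_def by (auto simp: closed_Compl less_le)
  have \<zeta>01: "0 \<le> \<zeta> n x" "\<zeta> n x \<le> 1" for n x
    unfolding \<zeta>_def by auto
  have cont_\<rho>: "continuous_on A \<rho>" for A
    unfolding \<rho>_def by (intro continuous_intros)
  have cont_\<zeta>: "continuous_on A (\<zeta> n)" for A n
    unfolding \<zeta>_def
    by (intro continuous_on_min continuous_on_max continuous_on_diff continuous_on_mult_left
        continuous_on_const cont_\<rho>)
  have \<zeta>_1: "eventually (\<lambda>n. \<zeta> n x = 1) sequentially" if "x \<in> \<Omega>" for x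
  proof -
    have "0 < \<rho> x"
      using \<rho>_pos that by simp
    then obtain N :: nat where N: "2 < real N * \<rho> x"
      using reals_Archimedean3 by metis
    have "\<zeta> n x = 1" if "n \<ge> N" for n
    proof -
      have "real N * \<rho> x \<le> real n * \<rho> x"
        using that \<open>0 < \<rho> x\<close> by (intro mult_right_mono) auto
      with N show ?thesis
        unfolding \<zeta>_def by simp
    qed
    then show ?thesis
      by (rule eventually_sequentiallyI)
  qed
  have w_cont: "continuous_on \<Omega> w"
    using w by (rule uniformly_continuous_imp_continuous)
  have w_int: "integrable M w"
    using w by (rule uniformly_continuous_integrable)
  have \<psi>_int: "integrable M (\<lambda>x. \<zeta> n x * w x)" for n
  proof (rule Bochner_Integration.integrable_bound[OF w_int])
    show "(\<lambda>x. \<zeta> n x * w x) \<in> borel_measurable M"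
      using cont_\<zeta> w_cont by (intro continuous_measurable continuous_on_mult)
    show "AE x in M. norm (\<zeta> n x * w x) \<le> norm (w x)"
      using \<zeta>01 by (intro AE_I2) (auto simp: abs_mult intro!: mult_left_le_one_le)
  qed
  have "(\<lambda>n. \<integral>x. \<bar>w x - \<zeta> n x * w x\<bar> \<partial>M) \<longlonglongrightarrow> (\<integral>x. 0 \<partial>M)"
  proof (rule integral_dominated_convergence)
    show "(\<lambda>x. \<bar>w x - \<zeta> n x * w x\<bar>) \<in> borel_measurable M" for n
      using w_int \<psi>_int by simp
    show "integrable M (\<lambda>x. \<bar>w x\<bar>)"
      using w_int by simp
    show "AE x in M. (\<lambda>n. \<bar>w x - \<zeta> n x * w x\<bar>) \<longlonglongrightarrow> 0"
    proof (rule AE_I2)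
      fix x assume "x \<in> space M"
      then have "eventually (\<lambda>n. \<zeta> n x = 1) sequentially"
        using \<zeta>_1 by simp
      then have "eventually (\<lambda>n. \<bar>w x - \<zeta> n x * w x\<bar> = 0) sequentially"
        by eventually_elim simp
      then show "(\<lambda>n. \<bar>w x - \<zeta> n x * w x\<bar>) \<longlonglongrightarrow> 0"
        by (rule tendsto_eventually)
    qed
    show "AE x in M. norm \<bar>w x - \<zeta> n x * w x\<bar> \<le> \<bar>w x\<bar>" for n
    proof (rule AE_I2)
      fix x
      have "\<bar>w x - \<zeta> n x * w x\<bar> = (1 - \<zeta> n x) * \<bar>w x\<bar>"
        using \<zeta>01[of n x] by (simp add: abs_mult flip: left_diff_distrib[of 1 _ "w x", simplified])
      then show "norm \<bar>w x - \<zeta> n x * w x\<bar> \<le> \<bar>w x\<bar>"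
        using \<zeta>01[of n x] by (simp add: mult_left_le_one_le)
    qed
  qed simp
  then have "(\<lambda>n. \<integral>x. \<bar>w x - \<zeta> n x * w x\<bar> \<partial>M) \<longlonglongrightarrow> 0"
    by simp
  then have "eventually (\<lambda>n. (\<integral>x. \<bar>w x - \<zeta> n x * w x\<bar> \<partial>M) < s * m / C) sequentially"
    using s m bound_pos by (intro order_tendstoD) auto
  \<comment> \<open>Requiring the cut-off to be 1 at one fixed point guarantees that the truncated
    function is not identically zero.\<close>
  moreover obtain x0 where x0: "x0 \<in> \<Omega>"
    using nonempty_dom by blast
  ultimately have "eventually (\<lambda>n. (\<integral>x. \<bar>w x - \<zeta> n x * w x\<bar> \<partial>M) < s * m / C \<and>
      \<zeta> n x0 = 1) sequentially"
    using \<zeta>_1[OF x0] by (simp add: eventually_conj)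
  then obtain n where n: "(\<integral>x. \<bar>w x - \<zeta> n x * w x\<bar> \<partial>M) < s * m / C" "\<zeta> n x0 = 1"
    unfolding eventually_sequentially by blast
  define \<psi> where "\<psi> x = \<zeta> n x * w x" for x
  define S where "S = closure \<Omega> \<inter> {x. 1 \<le> real n * \<rho> x}"
  have "closed {x. 1 \<le> real n * \<rho> x}"
    by (intro closed_Collect_le continuous_on_mult_left continuous_on_const cont_\<rho>)
  then have "compact S"
    unfolding S_def using bounded_dom by (intro compact_Int_closed) auto
  moreover have "S \<subseteq> \<Omega>"
  proof
    fix x assume "x \<in> S"
    then have "0 < real n * \<rho> x"
      unfolding S_def by simp
    then have "0 < \<rho> x"
      by (simp add: zero_less_mult_iff)
    then show "x \<in> \<Omega>"
      using \<rho>_pos by simp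
  qed
  moreover have "\<forall>x\<in>\<Omega> - S. \<psi> x = 0"
    using closure_subset[of \<Omega>] unfolding S_def \<psi>_def \<zeta>_def by auto
  moreover have \<psi>_nonneg: "0 \<le> \<psi> x" and \<psi>_le: "\<psi> x \<le> w x" if "x \<in> \<Omega>" for x
  proof -
    have "0 \<le> w x"
      using m that by (meson less_imp_le order_trans)
    then show "0 \<le> \<psi> x" "\<psi> x \<le> w x"
      using \<zeta>01[of n x] unfolding \<psi>_def by (auto intro: mult_left_le_one_le)
  qed
  moreover have "continuous_on \<Omega> \<psi>"
    unfolding \<psi>_def using cont_\<zeta> w_cont by (intro continuous_on_mult)
  moreover have "\<exists>x\<in>\<Omega>. \<psi> x \<noteq> 0"
    using x0 n(2) m unfolding \<psi>_def by (intro bexI[of _ x0]) auto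
  moreover have "(\<beta> x - s) * \<psi> x \<le> L \<psi> x" if x: "x \<in> \<Omega>" for x
  \<comment> \<open>A nonpositive coefficient makes the left side nonpositive while
    \<open>L \<psi>\<close> is nonnegative. With a positive one, \<psi> on the left may be replaced
    by the larger \<open>w\<close>.\<close>
  proof (cases "\<beta> x - s \<le> 0")
    case True
    then show ?thesis
      using \<psi>_nonneg x nlop_nonneg[OF x, of \<psi>] by (meson mult_nonpos_nonneg order_trans)
  next
    case False
    have "L w x - L \<psi> x = L (\<lambda>y. w y - \<psi> y) x"
      using nlop_diff[OF x w_int, of \<psi>] \<psi>_int[of n] unfolding \<psi>_def by simp
    also have "\<dots> \<le> C * (\<integral>y. \<bar>w y - \<psi> y\<bar> \<partial>M)"
      using nlop_abs_le[OF x, of "\<lambda>y. w y - \<psi> y"] w_int \<psi>_int[of n] unfolding \<psi>_def by simp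
    also have "\<dots> \<le> s * m"
      using n(1) bound_pos unfolding \<psi>_def by (simp add: pos_less_divide_eq mult.commute)
    also have "\<dots> \<le> s * w x"
      using m x s by simp
    finally have "\<beta> x * w x - s * w x \<le> L \<psi> x"
      using sub x by (smt (verit))
    moreover have "(\<beta> x - s) * \<psi> x \<le> (\<beta> x - s) * w x"
      using False \<psi>_le[OF x] by (intro mult_left_mono) auto
    ultimately show ?thesis
      by (simp add: left_diff_distrib)
  qed
  ultimately show ?thesis
    by (intro exI[of _ \<psi>] exI[of _ S] conjI) (assumption | blast)+
qed

subsection \<open>Symmetric kernels\<close>

text \<open>The kernel is a Caratheodory function, so up to a null set in the second variable it is the
  pointwise limit of kernels that are constant on countably many cells in the first variable.\<close>

lemma exists_jointly_measurable_kernel: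
  "\<exists>K'. case_prod K' \<in> borel_measurable (M \<Otimes>\<^sub>M M) \<and>
    (\<forall>x\<in>\<Omega>. \<forall>y\<in>\<Omega>. 0 \<le> K' x y \<and> K' x y \<le> C) \<and> (AE y in M. \<forall>x\<in>\<Omega>. K' x y = K x y)"
proof -
  obtain N where N: "{y \<in> space M. \<not> uniformly_continuous_on \<Omega> (\<lambda>x. K x y)} \<subseteq> N"
      "emeasure M N = 0" "N \<in> sets M"
    using kernel_uniformly_continuous by (rule AE_E)
  obtain D :: "'a set" where D: "countable D" "\<And>X. open X \<Longrightarrow> X \<noteq> {} \<Longrightarrow> \<exists>d\<in>D. d \<in> X"
    using countable_dense_exists by blast
  have "D \<inter> \<Omega> \<noteq> {}"
    using D(2)[OF open_dom nonempty_dom] by blast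
  define q where "q = from_nat_into (D \<inter> \<Omega>)"
  have range_q: "range q = D \<inter> \<Omega>"
    unfolding q_def using D(1) \<open>D \<inter> \<Omega> \<noteq> {}\<close> by (intro range_from_nat_into) auto
  then have q_dom: "q i \<in> \<Omega>" for i
    by blast
  have q_dense: "\<exists>i. dist x (q i) < e" if "x \<in> \<Omega>" "0 < e" for x e
  proof -
    have "open (\<Omega> \<inter> ball x e)" "\<Omega> \<inter> ball x e \<noteq> {}"
      using open_dom that by (auto intro: exI[of _ x])
    then obtain y where "y \<in> D" "y \<in> \<Omega> \<inter> ball x e"
      using D(2) by blast
    moreover then obtain i where "y = q i"
      using range_q by blast
    ultimately show ?thesis
      by auto
  qed
  \<comment> \<open>The first point of the dense sequence near \<open>x\<close> is a measurable
    choice. As it ranges over a countable set, joint measurability of \<open>F n\<close> follows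
    from that of the single slices \<open>K (q i)\<close>.\<close>
  define k where "k n x = (LEAST i. dist x (q i) < 1 / real (Suc n))" for n x
  have k: "dist x (q (k n x)) < 1 / real (Suc n)" if "x \<in> \<Omega>" for n x
    unfolding k_def using q_dense[OF that, of "1 / real (Suc n)"]
    by (intro LeastI_ex[of "\<lambda>i. dist x (q i) < 1 / real (Suc n)"]) simp
  have dist_meas: "(\<lambda>x. dist x z) \<in> borel_measurable M" for z
    by (intro continuous_measurable continuous_on_dist continuous_on_id continuous_on_const)
  have k_meas: "k n \<in> measurable M (count_space UNIV)" for n
    unfolding k_def
    by (intro measurable_Least borel_measurable_pred_less dist_meas borel_measurable_const)
  define F where "F n p = K (q (k n (fst p))) (snd p) * indicator (\<Omega> - N) (snd p)" for n p
  have F_meas: "F n \<in> borel_measurable (M \<Otimes>\<^sub>M M)" for n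
  proof -
    have "(\<lambda>y. K (q i) y * indicator (\<Omega> - N) y) \<in> borel_measurable M" for i
      using kernel_measurable[OF q_dom] N(3) sets.top[of M]
      by (intro borel_measurable_times borel_measurable_indicator sets.Diff) auto
    then have "(\<lambda>p. K (q i) (snd p) * indicator (\<Omega> - N) (snd p)) \<in> borel_measurable (M \<Otimes>\<^sub>M M)" for i
      by (rule measurable_compose[OF measurable_snd])
    then show ?thesis
      unfolding F_def
      by (rule measurable_compose_countable[OF _ measurable_compose[OF measurable_fst k_meas]])
  qed
  \<comment> \<open>With the exceptional \<open>y\<close> in \<open>N\<close> set to zero, the
    approximations converge at every pair, not just almost everywhere; for every other
    \<open>y\<close> in \<Omega> the whole slice in \<open>x\<close> agrees with
    \<open>K\<close>.\<close>
  define K' where "K' x y = K x y * indicator (\<Omega> - N) y" for x y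
  have "case_prod K' \<in> borel_measurable (M \<Otimes>\<^sub>M M)"
  proof (rule borel_measurable_LIMSEQ_real[OF _ F_meas])
    fix p assume "p \<in> space (M \<Otimes>\<^sub>M M)"
    then obtain x y where p: "p = (x, y)" "x \<in> \<Omega>" "y \<in> \<Omega>"
      by (auto simp: space_pair_measure)
    show "(\<lambda>n. F n p) \<longlonglongrightarrow> case_prod K' p"
    proof (cases "y \<in> N")
      case True
      then show ?thesis
        unfolding F_def K'_def p(1) by simp
    next
      case False
      then have "uniformly_continuous_on \<Omega> (\<lambda>x. K x y)"
        using N(1) p(3) by auto
      then have "continuous_on \<Omega> (\<lambda>x. K x y)"
        by (rule uniformly_continuous_imp_continuous)
      moreover have "(\<lambda>n. q (k n x)) \<longlonglongrightarrow> x"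
      proof (rule metric_LIMSEQ_I)
        fix e :: real assume "0 < e"
        then obtain m where m: "1 / real (Suc m) < e"
          using nat_approx_posE by blast
        have "dist (q (k n x)) x < e" if "m \<le> n" for n
        proof -
          have "1 / real (Suc n) \<le> 1 / real (Suc m)"
            using that by (intro divide_left_mono) auto
          then show ?thesis
            using k[OF p(2), of n] m by (simp add: dist_commute)
        qed
        then show "\<exists>m. \<forall>n\<ge>m. dist (q (k n x)) x < e"
          by blast
      qed
      ultimately have "(\<lambda>n. K (q (k n x)) y) \<longlonglongrightarrow> K x y"
        using q_dom p(2) by (intro continuous_on_tendsto_compose[where f = "\<lambda>x. K x y"]) auto
      then show ?thesis
        unfolding F_def K'_def p(1) using False p(3) by simp
    qed
  qed
  moreover have "0 \<le> K' x y \<and> K' x y \<le> C" if "x \<in> \<Omega>" "y \<in> \<Omega>" for x y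
    using kernel_nonneg[OF that] kernel_le[OF that] bound_pos
    unfolding K'_def by (auto simp: indicator_def)
  moreover have "AE y in M. \<forall>x\<in>\<Omega>. K' x y = K x y"
  proof (rule AE_I')
    show "N \<in> null_sets M"
      using N(2,3) by blast
    show "{y \<in> space M. \<not> (\<forall>x\<in>\<Omega>. K' x y = K x y)} \<subseteq> N"
      unfolding K'_def by (auto simp: indicator_def)
  qed
  ultimately show ?thesis
    by (intro exI[of _ K']) blast
qed

text \<open>Fubini needs joint measurability, while \<open>K\<close> is only measurable in one
  variable and continuous in the other, so it is applied to \<open>K'\<close>. The latter need not
  be symmetric. But its exceptional null set of \<open>y\<close> does not depend on
  \<open>x\<close>, so both iterated integrals can be rewritten in terms of \<open>K\<close>, where
  symmetry is available.\<close>

lemma integral_mult_nlop_commute: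
  assumes sym: "\<And>x y. x \<in> \<Omega> \<Longrightarrow> y \<in> \<Omega> \<Longrightarrow> K x y = K y x"
    and f: "integrable M f" and g: "integrable M g"
  shows "(\<integral>x. f x * L g x \<partial>M) = (\<integral>x. g x * L f x \<partial>M)"
proof -
  obtain K' where K'_meas: "case_prod K' \<in> borel_measurable (M \<Otimes>\<^sub>M M)"
    and K'_bounds: "\<And>x y. x \<in> \<Omega> \<Longrightarrow> y \<in> \<Omega> \<Longrightarrow> 0 \<le> K' x y \<and> K' x y \<le> C"
    and K'_AE: "AE y in M. \<forall>x\<in>\<Omega>. K' x y = K x y"
    using exists_jointly_measurable_kernel by blast
  interpret P: pair_sigma_finite M M
    by unfold_locales
  define H where "H x y = K' x y * (f x * g y)" for x y
  have H_meas: "case_prod H \<in> borel_measurable (M \<Otimes>\<^sub>M M)"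
  proof -
    have "(\<lambda>p. case_prod K' p * (f (fst p) * g (snd p))) \<in> borel_measurable (M \<Otimes>\<^sub>M M)"
      using K'_meas f g
      by (intro borel_measurable_times measurable_compose[OF measurable_fst]
          measurable_compose[OF measurable_snd]) auto
    then show ?thesis
      unfolding H_def by (simp add: case_prod_beta')
  qed
  have H_slice_meas: "H x \<in> borel_measurable M" if "x \<in> \<Omega>" for x
    using measurable_Pair2[OF H_meas, of x] that by simp
  have H_le: "\<bar>H x y\<bar> \<le> C * \<bar>f x\<bar> * \<bar>g y\<bar>" if "x \<in> \<Omega>" "y \<in> \<Omega>" for x y
    using K'_bounds[OF that] unfolding H_def abs_mult by (simp add: mult_right_mono mult.assoc)
  have H_slice_int: "integrable M (H x)" if "x \<in> \<Omega>" for x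
  proof (rule Bochner_Integration.integrable_bound)
    show "integrable M (\<lambda>y. C * \<bar>f x\<bar> * \<bar>g y\<bar>)"
      using g by simp
    show "AE y in M. norm (H x y) \<le> norm (C * \<bar>f x\<bar> * \<bar>g y\<bar>)"
      using H_le[OF that] bound_pos by (intro AE_I2) (auto simp: abs_mult)
  qed (rule H_slice_meas[OF that])
  have H_int: "integrable (M \<Otimes>\<^sub>M M) (case_prod H)"
  proof (rule P.Fubini_integrable[OF H_meas])
    show "integrable M (\<lambda>x. \<integral>y. norm (case_prod H (x, y)) \<partial>M)"
    proof (rule Bochner_Integration.integrable_bound)
      show "integrable M (\<lambda>x. C * (\<integral>y. \<bar>g y\<bar> \<partial>M) * \<bar>f x\<bar>)"
        using f by simp
      show "(\<lambda>x. \<integral>y. norm (case_prod H (x, y)) \<partial>M) \<in> borel_measurable M"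
        using H_meas by (intro borel_measurable_lebesgue_integral) simp
      show "AE x in M. norm (\<integral>y. norm (case_prod H (x, y)) \<partial>M)
          \<le> norm (C * (\<integral>y. \<bar>g y\<bar> \<partial>M) * \<bar>f x\<bar>)"
      proof (rule AE_I2)
        fix x assume "x \<in> space M"
        then have x: "x \<in> \<Omega>" by simp
        have "(\<integral>y. \<bar>H x y\<bar> \<partial>M) \<le> (\<integral>y. C * \<bar>f x\<bar> * \<bar>g y\<bar> \<partial>M)"
          using H_slice_int[OF x] g H_le[OF x] by (intro integral_mono) auto
        then show "norm (\<integral>y. norm (case_prod H (x, y)) \<partial>M)
            \<le> norm (C * (\<integral>y. \<bar>g y\<bar> \<partial>M) * \<bar>f x\<bar>)"
          using bound_pos by (simp add: abs_mult mult_ac)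
      qed
    qed
    show "AE x in M. integrable M (\<lambda>y. case_prod H (x, y))"
      using H_slice_int by (intro AE_I2) simp
  qed
  have "(\<integral>x. f x * L g x \<partial>M) = (\<integral>x. (\<integral>y. H x y \<partial>M) \<partial>M)"
  proof (rule Bochner_Integration.integral_cong)
    fix x assume "x \<in> space M"
    then have x: "x \<in> \<Omega>" by simp
    have "(\<integral>y. H x y \<partial>M) = (\<integral>y. f x * (K x y * g y) \<partial>M)"
    proof (rule integral_cong_AE)
      show "AE y in M. H x y = f x * (K x y * g y)"
        using K'_AE by eventually_elim (use x in \<open>simp add: H_def\<close>)
      show "(\<lambda>y. f x * (K x y * g y)) \<in> borel_measurable M"
        using kernel_mult_integrable[OF x g] by simp
    qed (rule H_slice_meas[OF x])
    then show "f x * L g x = (\<integral>y. H x y \<partial>M)"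
      unfolding nlop_def by simp
  qed simp
  also have "\<dots> = (\<integral>y. (\<integral>x. H x y \<partial>M) \<partial>M)"
    using P.Fubini_integral[OF H_int] by simp
  also have "\<dots> = (\<integral>y. g y * L f y \<partial>M)"
  proof (rule integral_cong_AE)
    show "(\<lambda>y. \<integral>x. H x y \<partial>M) \<in> borel_measurable M"
      using P.integrable_snd[OF H_int] by (rule borel_measurable_integrable)
    show "(\<lambda>y. g y * L f y) \<in> borel_measurable M"
      using g nlop_uniformly_continuous[OF f] uniformly_continuous_integrable
      by (intro borel_measurable_times) auto
    have "AE y in M. y \<in> \<Omega>"
      by (rule AE_I2) simp
    with K'_AE show "AE y in M. (\<integral>x. H x y \<partial>M) = g y * L f y"
    proof eventually_elim
      fix y assume K'_y: "\<forall>x\<in>\<Omega>. K' x y = K x y" and y: "y \<in> \<Omega>"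
      have "(\<integral>x. H x y \<partial>M) = (\<integral>x. g y * (K y x * f x) \<partial>M)"
        using K'_y sym[OF _ y] by (intro Bochner_Integration.integral_cong) (auto simp: H_def)
      then show "(\<integral>x. H x y \<partial>M) = g y * L f y"
        unfolding nlop_def by simp
    qed
  qed
  finally show ?thesis .
qed

lemma integrable_mult_uniformly_continuous:
  fixes f :: "'a \<Rightarrow> real"
  assumes "integrable M f" "uniformly_continuous_on \<Omega> u"
  shows "integrable M (\<lambda>x. u x * f x)"
proof -
  obtain B where B: "0 < B" "\<forall>x\<in>\<Omega>. \<bar>u x\<bar> \<le> B"
    using uniformly_continuous_bounded[OF assms(2)] by blast
  show ?thesis
  proof (rule Bochner_Integration.integrable_bound)
    show "integrable M (\<lambda>x. B * f x)"
      using assms(1) by simp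
    show "(\<lambda>x. u x * f x) \<in> borel_measurable M"
      using assms uniformly_continuous_integrable by (intro borel_measurable_times) auto
    show "AE x in M. norm (u x * f x) \<le> norm (B * f x)"
      using B by (intro AE_I2) (auto simp: abs_mult intro!: mult_right_mono)
  qed
qed

lemma square_integrable_imp_integrable:
  fixes f :: "'a \<Rightarrow> real"
  assumes "f \<in> borel_measurable M" "integrable M (\<lambda>x. (f x)\<^sup>2)"
  shows "integrable M f"
proof (rule Bochner_Integration.integrable_bound)
  show "integrable M (\<lambda>x. 1 + (f x)\<^sup>2)"
    using assms(2) by simp
  have "\<bar>t\<bar> \<le> 1 + t\<^sup>2" for t :: real
    using sum_squares_ge_zero[of "\<bar>t\<bar> - 1" 0] zero_le_power2[of "\<bar>t\<bar> - 1"]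
    by (simp add: power2_diff)
  then show "AE x in M. norm (f x) \<le> norm (1 + (f x)\<^sup>2)"
    by (intro AE_I2) simp
qed (rule assms(1))

text \<open>The AM-GM inequality \<open>2 f(x) f(y) \<le> f(x)\<^sup>2 g(y) / g(x) + f(y)\<^sup>2 g(x) / g(y)\<close> compares the
  quadratic form with the supersolution.\<close>

lemma quadratic_form_le:
  assumes sym: "\<And>x y. x \<in> \<Omega> \<Longrightarrow> y \<in> \<Omega> \<Longrightarrow> K x y = K y x"
    and a: "uniformly_continuous_on \<Omega> a"
    and g: "continuous_on (closure \<Omega>) g" "\<forall>x\<in>closure \<Omega>. 0 < g x"
      "\<forall>x\<in>\<Omega>. L g x + a x * g x + l * g x \<le> 0"
    and f: "f \<in> borel_measurable M" "integrable M (\<lambda>x. (f x)\<^sup>2)"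
  shows "(\<integral>x. (L f x + a x * f x) * f x \<partial>M) \<le> - l * (\<integral>x. (f x)\<^sup>2 \<partial>M)"
proof -
  obtain \<delta> where \<delta>: "0 < \<delta>" "\<forall>x\<in>\<Omega>. \<delta> \<le> g x"
    using continuous_pos_lower_bound[OF g(1,2)] by blast
  then have g_pos: "0 < g x" if "x \<in> \<Omega>" for x
    using that by fastforce
  have g_uc: "uniformly_continuous_on \<Omega> g"
    using g(1) uniformly_continuous_iff_extension by blast
  have g_int: "integrable M g"
    using g_uc by (rule uniformly_continuous_integrable)
  have f_int: "integrable M f"
    using f by (rule square_integrable_imp_integrable)
  \<comment> \<open>The test function of a Picone-type argument: since \<open>h * g = f^2\<close>,
    multiplying the supersolution inequality by \<open>h\<close> leaves only terms in
    \<open>f^2\<close>.\<close>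
  define h where "h x = (f x)\<^sup>2 / g x" for x
  have "uniformly_continuous_on \<Omega> (\<lambda>x. 1 / g x)"
    using \<delta> by (intro uniformly_continuous_divide[OF uniformly_continuous_on_const g_uc \<delta>(1)]) auto
  then have h_int: "integrable M h"
    using integrable_mult_uniformly_continuous[OF f(2)] unfolding h_def by fastforce
  have Lf_f: "integrable M (\<lambda>x. L f x * f x)"
    using f_int nlop_uniformly_continuous[OF f_int] by (rule integrable_mult_uniformly_continuous)
  have h_Lg: "integrable M (\<lambda>x. h x * L g x)"
    using integrable_mult_uniformly_continuous[OF h_int nlop_uniformly_continuous[OF g_int]]
    by (simp add: mult.commute)
  have Lh_g: "integrable M (\<lambda>x. g x * L h x)"
    using integrable_mult_uniformly_continuous[OF g_int nlop_uniformly_continuous[OF h_int]]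
    by (simp add: mult.commute)
  have a_ff: "integrable M (\<lambda>x. a x * (f x)\<^sup>2)"
    using f(2) a by (rule integrable_mult_uniformly_continuous)
  have pointwise: "2 * (L f x * f x) \<le> h x * L g x + g x * L h x" if x: "x \<in> \<Omega>" for x
  proof -
    have amgm: "2 * f x * f y \<le> h x * g y + g x * h y" if y: "y \<in> \<Omega>" for y
    proof -
      have "h x * g y + g x * h y - 2 * f x * f y = (f x * g y - f y * g x)\<^sup>2 / (g x * g y)"
        unfolding h_def using g_pos[OF x] g_pos[OF y]
        by (simp add: field_simps power2_eq_square)
      also have "\<dots> \<ge> 0"
        using g_pos[OF x] g_pos[OF y] by simp
      finally show ?thesis by simp
    qed
    have "2 * (L f x * f x) = (\<integral>y. 2 * f x * (K x y * f y) \<partial>M)"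
      unfolding nlop_def by simp
    also have "\<dots> \<le> (\<integral>y. h x * (K x y * g y) + g x * (K x y * h y) \<partial>M)"
    proof (rule integral_mono)
      show "integrable M (\<lambda>y. 2 * f x * (K x y * f y))"
        "integrable M (\<lambda>y. h x * (K x y * g y) + g x * (K x y * h y))"
        using kernel_mult_integrable[OF x] f_int g_int h_int by simp_all
      fix y assume "y \<in> space M"
      then have y: "y \<in> \<Omega>" by simp
      have "K x y * (2 * f x * f y) \<le> K x y * (h x * g y + g x * h y)"
        using amgm[OF y] kernel_nonneg[OF x y] by (rule mult_left_mono)
      then show "2 * f x * (K x y * f y) \<le> h x * (K x y * g y) + g x * (K x y * h y)"
        by (simp add: algebra_simps)
    qed
    also have "\<dots> = h x * L g x + g x * L h x"
      unfolding nlop_def using kernel_mult_integrable[OF x] g_int h_int by simp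
    finally show ?thesis .
  qed
  have "2 * (\<integral>x. L f x * f x \<partial>M) \<le> (\<integral>x. h x * L g x + g x * L h x \<partial>M)"
    unfolding integral_mult_right_zero[symmetric]
    using Lf_f h_Lg Lh_g pointwise by (intro integral_mono) auto
  \<comment> \<open>Symmetry enters here: the two terms produced by AM-GM have the same
    integral.\<close>
  also have "\<dots> = 2 * (\<integral>x. h x * L g x \<partial>M)"
    using h_Lg Lh_g integral_mult_nlop_commute[OF sym h_int g_int] by simp
  finally have "(\<integral>x. L f x * f x \<partial>M) \<le> (\<integral>x. h x * L g x \<partial>M)"
    by simp
  also have "\<dots> \<le> (\<integral>x. - (a x * (f x)\<^sup>2) - l * (f x)\<^sup>2 \<partial>M)"
  proof (rule integral_mono)
    fix x assume "x \<in> space M"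
    then have x: "x \<in> \<Omega>" by simp
    have "h x * L g x \<le> h x * (- (a x * g x) - l * g x)"
      using g(3) x g_pos[OF x] unfolding h_def by (intro mult_left_mono) fastforce+
    also have "\<dots> = - (a x * (f x)\<^sup>2) - l * (f x)\<^sup>2"
      unfolding h_def using g_pos[OF x] by (simp add: field_simps)
    finally show "h x * L g x \<le> - (a x * (f x)\<^sup>2) - l * (f x)\<^sup>2" .
  qed (use h_Lg a_ff f(2) in auto)
  also have "\<dots> = - (\<integral>x. a x * (f x)\<^sup>2 \<partial>M) - l * (\<integral>x. (f x)\<^sup>2 \<partial>M)"
    using a_ff f(2) by simp
  finally have "(\<integral>x. L f x * f x \<partial>M) + (\<integral>x. a x * (f x)\<^sup>2 \<partial>M) \<le> - l * (\<integral>x. (f x)\<^sup>2 \<partial>M)"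
    by simp
  moreover have "(\<integral>x. (L f x + a x * f x) * f x \<partial>M)
      = (\<integral>x. L f x * f x \<partial>M) + (\<integral>x. a x * (f x)\<^sup>2 \<partial>M)"
    using Lf_f a_ff by (simp add: distrib_right power2_eq_square mult.assoc)
  ultimately show ?thesis
    by simp
qed

end

section \<open>Irreducibility\<close>

locale irreducible_kernel = bounded_kernel +
  fixes r c :: real
  assumes connected_dom: "connected \<Omega>"
    and radius_pos: "0 < r" and lower_pos: "0 < c"
    and kernel_ge: "\<And>x y. x \<in> \<Omega> \<Longrightarrow> y \<in> \<Omega> \<Longrightarrow> dist x y < r \<Longrightarrow> c \<le> K x y"
begin

lemma nlop_ge_local:
  assumes "x \<in> \<Omega>" "A \<in> sets M" "\<And>y. y \<in> A \<Longrightarrow> dist x y < r"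
    and "integrable M v" "\<And>y. y \<in> \<Omega> \<Longrightarrow> 0 \<le> v y"
  shows "c * (\<integral>y. v y * indicator A y \<partial>M) \<le> L v x"
proof -
  have "(\<integral>y. c * (v y * indicator A y) \<partial>M) \<le> L v x"
    unfolding nlop_def
  proof (rule integral_mono)
    show "integrable M (\<lambda>y. c * (v y * indicator A y))"
      using assms(2,4) by (intro integrable_mult_right integrable_real_mult_indicator)
    show "integrable M (\<lambda>y. K x y * v y)"
      using assms(1,4) by (rule kernel_mult_integrable)
    fix y assume "y \<in> space M"
    then have "y \<in> \<Omega>" by simp
    then show "c * (v y * indicator A y) \<le> K x y * v y"
      using assms(1,3,5) kernel_ge kernel_nonneg
      by (cases "y \<in> A") (auto intro: mult_right_mono)
  qed
  then show ?thesis by simp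
qed

end

section \<open>The weighted operator and its iterates\<close>

locale weighted_kernel = irreducible_kernel +
  fixes b :: "'a \<Rightarrow> real" and d B :: real
  assumes weight_uniformly_continuous: "uniformly_continuous_on \<Omega> b"
    and weight_ge: "\<And>x. x \<in> \<Omega> \<Longrightarrow> d \<le> b x" and weight_bound_pos: "0 < d"
    and weight_le: "\<And>x. x \<in> \<Omega> \<Longrightarrow> b x \<le> B"
begin

text \<open>For \<open>b = - a - l\<close>, a positive \<open>u\<close> satisfies the supersolution
  inequality with parameter \<open>l\<close> exactly when \<open>T u \<le> u\<close>, and the
  subsolution inequality exactly when \<open>T u \<ge> u\<close>.\<close>

definition T :: "('a \<Rightarrow> real) \<Rightarrow> 'a \<Rightarrow> real" where
  "T f x = L f x / b x"

lemma weight_pos: "x \<in> \<Omega> \<Longrightarrow> 0 < b x"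
  using weight_ge weight_bound_pos by force

lemma weight_upper_pos: "0 < B"
  using weight_pos weight_le nonempty_dom by force

lemma T_eq: "x \<in> \<Omega> \<Longrightarrow> b x * T f x = L f x"
  using weight_pos unfolding T_def by force

lemma T_uniformly_continuous: "integrable M f \<Longrightarrow> uniformly_continuous_on \<Omega> (T f)"
  unfolding T_def
  using nlop_uniformly_continuous weight_uniformly_continuous weight_bound_pos weight_ge
  by (rule uniformly_continuous_divide)

lemma T_funpow_uniformly_continuous:
  assumes "uniformly_continuous_on \<Omega> f"
  shows "uniformly_continuous_on \<Omega> ((T ^^ n) f)"
  by (induction n)
    (simp_all add: assms T_uniformly_continuous uniformly_continuous_integrable)

lemma T_funpow_integrable:
  "uniformly_continuous_on \<Omega> f \<Longrightarrow> integrable M ((T ^^ n) f)"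
  by (rule uniformly_continuous_integrable[OF T_funpow_uniformly_continuous])

lemma T_mono:
  assumes "x \<in> \<Omega>" "integrable M f" "integrable M g" "\<And>y. y \<in> \<Omega> \<Longrightarrow> f y \<le> g y"
  shows "T f x \<le> T g x"
  using nlop_mono[OF assms] weight_pos[OF assms(1)] unfolding T_def by (simp add: divide_right_mono)

lemma T_nonneg:
  assumes "x \<in> \<Omega>" "\<And>y. y \<in> \<Omega> \<Longrightarrow> 0 \<le> f y"
  shows "0 \<le> T f x"
  using nlop_nonneg[OF assms] weight_pos[OF assms(1)] unfolding T_def by simp

lemma T_funpow_nonneg:
  assumes "\<And>y. y \<in> \<Omega> \<Longrightarrow> 0 \<le> f y" "x \<in> \<Omega>"
  shows "0 \<le> (T ^^ n) f x"
  using assms(2) by (induction n arbitrary: x) (simp_all add: assms(1) T_nonneg)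

lemma T_funpow_mono:
  assumes f: "uniformly_continuous_on \<Omega> f" and g: "uniformly_continuous_on \<Omega> g"
    and le: "\<And>y. y \<in> \<Omega> \<Longrightarrow> f y \<le> g y"
    and "x \<in> \<Omega>"
  shows "(T ^^ n) f x \<le> (T ^^ n) g x"
  using \<open>x \<in> \<Omega>\<close>
  by (induction n arbitrary: x) (simp_all add: le T_mono T_funpow_integrable[OF f] T_funpow_integrable[OF g])

text \<open>Identities between iterates hold on \<Omega> only, not as equalities of functions; this
  allows substituting them under \<open>T\<close>.\<close>

lemma T_cong:
  assumes "\<And>y. y \<in> \<Omega> \<Longrightarrow> f y = g y"
  shows "T f x = T g x"
  unfolding T_def using nlop_cong[of f g, OF assms] by simp

lemma T_diff:
  assumes "x \<in> \<Omega>" "integrable M f" "integrable M g"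
  shows "T (\<lambda>y. f y - g y) x = T f x - T g x"
  unfolding T_def using nlop_diff[OF assms] by (simp add: diff_divide_distrib)

lemma T_funpow_diff:
  assumes f: "uniformly_continuous_on \<Omega> f" and g: "uniformly_continuous_on \<Omega> g"
    and "x \<in> \<Omega>"
  shows "(T ^^ n) (\<lambda>y. f y - g y) x = (T ^^ n) f x - (T ^^ n) g x"
  using \<open>x \<in> \<Omega>\<close>
proof (induction n arbitrary: x)
  case (Suc n)
  have "T ((T ^^ n) (\<lambda>y. f y - g y)) x = T (\<lambda>y. (T ^^ n) f y - (T ^^ n) g y) x"
    using Suc.IH by (rule T_cong)
  also have "\<dots> = T ((T ^^ n) f) x - T ((T ^^ n) g) x"
    using Suc.prems f g by (intro T_diff T_funpow_integrable)
  finally show ?case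
    by simp
qed simp

text \<open>A finite cover of the domain by balls of radius \<open>r / 4\<close> gives a connected graph of
  overlapping cells, and each application of \<open>T\<close> spreads a lower bound to a neighbouring cell.\<close>

lemma T_funpow_irreducible:
  "\<exists>n k. 0 < k \<and> (\<forall>v. uniformly_continuous_on \<Omega> v \<longrightarrow> (\<forall>x\<in>\<Omega>. 0 \<le> v x) \<longrightarrow>
    (\<forall>x\<in>\<Omega>. k * (\<integral>y. v y \<partial>M) \<le> (T ^^ n) v x))"
proof -
  have "compact (closure \<Omega>)"
    using bounded_dom by simp
  moreover have "closure \<Omega> \<subseteq> (\<Union>p\<in>closure \<Omega>. ball p (r/4))"
    using radius_pos by auto
  ultimately obtain P where P: "P \<subseteq> closure \<Omega>" "finite P" "closure \<Omega> \<subseteq> (\<Union>p\<in>P. ball p (r/4))"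
    using compactE_image[of "closure \<Omega>" "closure \<Omega>" "\<lambda>p. ball p (r/4)"] by (metis open_ball)
  define A where "A p = \<Omega> \<inter> ball p (r/4)" for p
  have A_sets: "A p \<in> sets M" for p
    unfolding A_def by (rule open_inter_ball_sets)
  have A_sub: "A p \<subseteq> \<Omega>" for p
    unfolding A_def by blast
  have A_open: "open (A p)" for p
    unfolding A_def using open_dom by blast
  have cover: "\<Omega> \<subseteq> (\<Union>p\<in>P. A p)"
    using P(3) closure_subset[of \<Omega>] unfolding A_def by blast
  have P_ne: "P \<noteq> {}"
    using cover nonempty_dom by blast
  have A_pos: "0 < measure M (A p)" if "p \<in> P" for p
    unfolding A_def using that P(1) radius_pos by (intro measure_ball_inter_dom_pos) auto
  have A_ne: "A p \<noteq> {}" if "p \<in> P" for p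
    using A_pos[OF that] by auto
  \<comment> \<open>Going from \<open>x\<close> via \<open>p\<close>, a common point
    \<open>z\<close> and \<open>q\<close> to \<open>y\<close> takes four segments shorter than
    \<open>r/4\<close>, so \<open>K x y \<ge> c\<close> across overlapping cells.\<close>
  have A_near: "dist x y < r" if "x \<in> A p" "y \<in> A q" "A p \<inter> A q \<noteq> {}" for x y p q
  proof -
    obtain z where z: "z \<in> A p" "z \<in> A q"
      using \<open>A p \<inter> A q \<noteq> {}\<close> by blast
    have "dist x y \<le> dist p x + dist p z + (dist q z + dist q y)"
      by (smt (verit) dist_commute dist_triangle)
    also have "\<dots> < r"
      using that z unfolding A_def by simp
    finally show ?thesis .
  qed
  define h where "h = Min ((\<lambda>p. measure M (A p)) ` P)"
  have h_pos: "0 < h"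
    unfolding h_def using P(2) P_ne A_pos by simp
  have h_le: "h \<le> measure M (A p)" if "p \<in> P" for p
    unfolding h_def using P(2) that by simp
  \<comment> \<open>Lower bound \<open>c\<close> of the kernel nearby, divided by the upper bound
    \<open>B\<close> of the weight.\<close>
  define \<kappa> where "\<kappa> = c / B"
  have \<kappa>_pos: "0 < \<kappa>"
    unfolding \<kappa>_def using lower_pos weight_upper_pos by simp
  have spread: "\<kappa> * (\<integral>y. v y * indicator (A q) y \<partial>M) \<le> T v x"
    if v: "uniformly_continuous_on \<Omega> v" "\<And>y. y \<in> \<Omega> \<Longrightarrow> 0 \<le> v y"
      and x: "x \<in> A p" and pq: "A p \<inter> A q \<noteq> {}" for v x p q
  proof -
    let ?I = "\<integral>y. v y * indicator (A q) y \<partial>M"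
    have x': "x \<in> \<Omega>"
      using x A_sub by blast
    have "0 \<le> ?I"
      using v(2) by (intro Bochner_Integration.integral_nonneg) auto
    then have "0 \<le> c * ?I"
      using lower_pos by simp
    then have "\<kappa> * ?I \<le> c * ?I / b x"
      unfolding \<kappa>_def using weight_le[OF x'] weight_pos[OF x'] weight_upper_pos
      by (simp add: divide_left_mono)
    also have "\<dots> \<le> T v x"
      unfolding T_def
      using nlop_ge_local[OF x' A_sets _ uniformly_continuous_integrable[OF v(1)] v(2)]
        A_near[OF x _ pq] weight_pos[OF x'] by (intro divide_right_mono) auto
    finally show ?thesis .
  qed
  \<comment> \<open>A pointwise bound \<open>m\<close> on a cell means mass at least
    \<open>h * m\<close> there, so each transfer to an overlapping cell costs the factor
    \<open>\<kappa> * h\<close>.\<close>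
  have spread_const: "\<kappa> * h * m \<le> T v x"
    if v: "uniformly_continuous_on \<Omega> v" "\<And>y. y \<in> \<Omega> \<Longrightarrow> 0 \<le> v y"
      and m: "0 \<le> m" "\<And>y. y \<in> A q \<Longrightarrow> m \<le> v y"
      and x: "x \<in> A p" and pq: "A p \<inter> A q \<noteq> {}" "q \<in> P" for v x p q m
  proof -
    have "h * m \<le> measure M (A q) * m"
      using h_le[OF pq(2)] m(1) by (rule mult_right_mono)
    also have "\<dots> = (\<integral>y. m * indicator (A q) y \<partial>M)"
      using A_sub[of q] by (simp add: mult.commute Int_absorb2)
    also have "\<dots> \<le> (\<integral>y. v y * indicator (A q) y \<partial>M)"
    proof (rule integral_mono)
      show "integrable M (\<lambda>y. m * indicator (A q) y)" "integrable M (\<lambda>y. v y * indicator (A q) y)"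
        using A_sets uniformly_continuous_integrable[OF v(1)]
        by (intro integrable_real_mult_indicator integrable_const; simp)+
    qed (use m in \<open>auto simp: indicator_def\<close>)
    finally have "\<kappa> * (h * m) \<le> \<kappa> * (\<integral>y. v y * indicator (A q) y \<partial>M)"
      using \<kappa>_pos by simp
    also have "\<dots> \<le> T v x"
      using v x pq(1) by (rule spread)
    finally show ?thesis
      by simp
  qed
  \<comment> \<open>\<open>J\<close> collects the cells already reached. One application of
    \<open>T\<close> converts mass into a pointwise bound on a first cell, hence the exponent
    \<open>Suc k\<close>; each further one adds a cell until none is left.\<close>
  have main: "\<exists>J\<subseteq>P. min (Suc k) (card P) \<le> card J \<and>
      (\<forall>p\<in>J. \<forall>x\<in>A p. (\<kappa> * h) ^ k * (\<kappa> * ((\<integral>y. v y \<partial>M) / card P)) \<le> (T ^^ Suc k) v x)"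
    if v: "uniformly_continuous_on \<Omega> v" "\<And>y. y \<in> \<Omega> \<Longrightarrow> 0 \<le> v y" for v k
  proof (induction k)
    case 0
    have v_int: "integrable M v"
      using v(1) by (rule uniformly_continuous_integrable)
    have "(\<integral>y. v y \<partial>M) \<le> (\<integral>y. (\<Sum>q\<in>P. v y * indicator (A q) y) \<partial>M)"
    proof (rule integral_mono)
      show "integrable M (\<lambda>y. \<Sum>q\<in>P. v y * indicator (A q) y)"
        using v_int A_sets by (intro Bochner_Integration.integrable_sum integrable_real_mult_indicator)
      fix y assume "y \<in> space M"
      then have y: "y \<in> \<Omega>" by simp
      then obtain q where q: "q \<in> P" "y \<in> A q"
        using cover by blast
      have "v y = v y * indicator (A q) y"
        using q by simp
      also have "\<dots> \<le> (\<Sum>q\<in>P. v y * indicator (A q) y)"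
        using q(1) P(2) v(2)[OF y] by (intro member_le_sum) auto
      finally show "v y \<le> (\<Sum>q\<in>P. v y * indicator (A q) y)" .
    qed (rule v_int)
    also have "\<dots> = (\<Sum>q\<in>P. \<integral>y. v y * indicator (A q) y \<partial>M)"
      using v_int A_sets by (intro Bochner_Integration.integral_sum integrable_real_mult_indicator)
    finally have le: "(\<integral>y. v y \<partial>M) \<le> (\<Sum>q\<in>P. \<integral>y. v y * indicator (A q) y \<partial>M)" .
    \<comment> \<open>Pigeonhole: some cell carries at least the average share of the mass.\<close>
    have "\<exists>q\<in>P. (\<integral>y. v y \<partial>M) / card P \<le> (\<integral>y. v y * indicator (A q) y \<partial>M)"
    proof (rule ccontr)
      assume "\<not> ?thesis"
      then have "(\<Sum>q\<in>P. \<integral>y. v y * indicator (A q) y \<partial>M) < (\<Sum>q\<in>P. (\<integral>y. v y \<partial>M) / card P)"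
        using P(2) P_ne by (intro sum_strict_mono) auto
      with le show False
        using P(2) P_ne by simp
    qed
    then obtain q where q: "q \<in> P" "(\<integral>y. v y \<partial>M) / card P \<le> (\<integral>y. v y * indicator (A q) y \<partial>M)"
      by blast
    have "\<kappa> * ((\<integral>y. v y \<partial>M) / card P) \<le> T v x" if "x \<in> A q" for x
    proof -
      have "\<kappa> * ((\<integral>y. v y \<partial>M) / card P) \<le> \<kappa> * (\<integral>y. v y * indicator (A q) y \<partial>M)"
        using q(2) \<kappa>_pos by (intro mult_left_mono) auto
      also have "\<dots> \<le> T v x"
        using A_ne[OF q(1)] by (intro spread[OF v that]) auto
      finally show ?thesis .
    qed
    with q(1) show ?case
      by (intro exI[of _ "{q}"]) auto
  next
    case (Suc k)
    define m where "m = (\<kappa> * h) ^ k * (\<kappa> * ((\<integral>y. v y \<partial>M) / card P))"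
    have m: "0 \<le> m"
      unfolding m_def using \<kappa>_pos h_pos v(2)
      by (intro mult_nonneg_nonneg zero_le_power divide_nonneg_nonneg
          Bochner_Integration.integral_nonneg) auto
    obtain J where J: "J \<subseteq> P" "min (Suc k) (card P) \<le> card J"
      "\<And>p x. p \<in> J \<Longrightarrow> x \<in> A p \<Longrightarrow> m \<le> (T ^^ Suc k) v x"
      using Suc.IH unfolding m_def by blast
    have next_step: "\<kappa> * h * m \<le> (T ^^ Suc (Suc k)) v x"
      if "x \<in> A p" "A p \<inter> A q \<noteq> {}" "q \<in> J" for x p q
    proof -
      have "\<kappa> * h * m \<le> T ((T ^^ Suc k) v) x"
        using that J v
        by (intro spread_const[of _ m q x p] T_funpow_uniformly_continuous T_funpow_nonneg m) auto
      then show ?thesis by simp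
    qed
    \<comment> \<open>Each cell overlaps itself, so cells once reached stay reached, with the same
      loss as new ones.\<close>
    have J_step: "\<kappa> * h * m \<le> (T ^^ Suc (Suc k)) v x" if "p \<in> J" "x \<in> A p" for p x
      using next_step[of x p p] that by blast
    have m_Suc: "\<kappa> * h * m = (\<kappa> * h) ^ Suc k * (\<kappa> * ((\<integral>y. v y \<partial>M) / card P))"
      unfolding m_def by simp
    show ?case
    proof (cases "J = P")
      case True
      then show ?thesis
        unfolding m_Suc[symmetric] using J_step by (intro exI[of _ P]) auto
    next
      case False
      have "card J \<noteq> 0"
        using J(2) P(2) P_ne by (auto simp: min_def split: if_splits)
      then obtain j where j: "j \<in> J"
        by fastforce
      obtain i where i: "i \<in> P - J"
        using False J(1) by blast
      \<comment> \<open>Otherwise reached and unreached cells would split the connected domain into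
        two disjoint nonempty open sets.\<close>
      have "(\<Union>p\<in>J. A p) \<inter> (\<Union>p\<in>P - J. A p) \<inter> \<Omega> \<noteq> {}"
      proof
        assume *: "(\<Union>p\<in>J. A p) \<inter> (\<Union>p\<in>P - J. A p) \<inter> \<Omega> = {}"
        have "\<Omega> \<subseteq> (\<Union>p\<in>J. A p) \<union> (\<Union>p\<in>P - J. A p)"
          using cover by blast
        then have "(\<Union>p\<in>J. A p) \<inter> \<Omega> = {} \<or> (\<Union>p\<in>P - J. A p) \<inter> \<Omega> = {}"
          using A_open by (intro connectedD[OF connected_dom _ _ *]) auto
        moreover have "A j \<noteq> {}" "A i \<noteq> {}"
          using A_ne i j J(1) by auto
        ultimately show False
          using i j A_sub by blast
      qed
      then obtain p q z where pq: "p \<in> P - J" "q \<in> J" "z \<in> A p" "z \<in> A q"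
        by blast
      have "\<kappa> * h * m \<le> (T ^^ Suc (Suc k)) v x" if "x \<in> A p" for x
        using next_step[OF that, of q] pq by blast
      moreover have "min (Suc (Suc k)) (card P) \<le> card (insert p J)"
        using J(1,2) pq(1) P(2) finite_subset[OF J(1) P(2)] by auto
      ultimately show ?thesis
        unfolding m_Suc[symmetric] using J_step pq(1) J(1)
        by (intro exI[of _ "insert p J"]) auto
    qed
  qed
  define k where "k = (\<kappa> * h) ^ card P * \<kappa> / card P"
  have "0 < k"
    unfolding k_def using \<kappa>_pos h_pos P(2) P_ne by (simp add: card_gt_0_iff)
  moreover have "k * (\<integral>y. v y \<partial>M) \<le> (T ^^ Suc (card P)) v x"
    if v: "uniformly_continuous_on \<Omega> v" "\<forall>x\<in>\<Omega>. 0 \<le> v x" and x: "x \<in> \<Omega>" for v x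
  proof -
    obtain J where J: "J \<subseteq> P" "min (Suc (card P)) (card P) \<le> card J"
      "\<forall>p\<in>J. \<forall>x\<in>A p. (\<kappa> * h) ^ card P * (\<kappa> * ((\<integral>y. v y \<partial>M) / card P)) \<le> (T ^^ Suc (card P)) v x"
      using main[of v "card P"] v by blast
    have "J = P"
      using J(1,2) P(2) by (intro card_seteq) auto
    moreover obtain p where "p \<in> P" "x \<in> A p"
      using cover x by blast
    ultimately have "(\<kappa> * h) ^ card P * (\<kappa> * ((\<integral>y. v y \<partial>M) / card P)) \<le> (T ^^ Suc (card P)) v x"
      using J(3) by blast
    then show ?thesis
      unfolding k_def by simp
  qed
  ultimately show ?thesis
    by blast
qed

text \<open>Partial sums of the Neumann series for \<open>T u - u = - 1\<close>: either some iterate \<open>T\<^sup>n 1\<close> is at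
  most \<open>1\<close> and the partial sum is a supersolution, or the mass of the partial sums diverges, so that
  the error term becomes negligible against the lower bound given by irreducibility.\<close>

lemma exists_supersolution_or_subsolution:
  assumes e: "0 < e"
  shows "(\<exists>u. uniformly_continuous_on \<Omega> u \<and> (\<forall>x\<in>\<Omega>. 1 \<le> u x \<and> L u x \<le> b x * u x)) \<or>
    (\<exists>w m. uniformly_continuous_on \<Omega> w \<and> 0 < m \<and> (\<forall>x\<in>\<Omega>. m \<le> w x \<and> (b x - e) * w x \<le> L w x))"
proof -
  define g where "g k = (T ^^ k) (\<lambda>_. 1)" for k
  define u where "u N x = (\<Sum>k<N. g k x)" for N x
  have g_0: "g 0 x = 1" for x
    unfolding g_def by simp
  have g_Suc: "g (Suc k) = T (g k)" for k
    unfolding g_def by simp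
  have g_uc: "uniformly_continuous_on \<Omega> (g k)" for k
    unfolding g_def by (intro T_funpow_uniformly_continuous uniformly_continuous_on_const)
  have g_int: "integrable M (g k)" for k
    using g_uc by (rule uniformly_continuous_integrable)
  have g_nonneg: "0 \<le> g k x" if "x \<in> \<Omega>" for k x
    unfolding g_def using that by (intro T_funpow_nonneg) auto
  have u_nonneg: "0 \<le> u N x" if "x \<in> \<Omega>" for N x
    unfolding u_def using that g_nonneg by (intro sum_nonneg) auto
  have u_uc: "uniformly_continuous_on \<Omega> (u N)" for N
  proof (induction N)
    case (Suc N)
    have "u (Suc N) = (\<lambda>x. u N x + g N x)"
      unfolding u_def by auto
    then show ?case
      using uniformly_continuous_on_add[OF Suc.IH g_uc] by simp
  qed (simp add: u_def uniformly_continuous_on_const)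
  \<comment> \<open>Telescoping: \<open>T\<close> shifts the series by one term, so
    \<open>g 0 = 1\<close> drops out and \<open>g N\<close> comes in.\<close>
  have T_u: "T (u N) x = u N x - 1 + g N x" if "x \<in> \<Omega>" for N x
  proof -
    have "T (u N) x = (\<Sum>k<N. T (g k) x)"
      unfolding T_def u_def using that g_int by (simp add: nlop_sum sum_divide_distrib)
    also have "\<dots> = (\<Sum>k<N. g (Suc k) x - g k x) + u N x"
      unfolding u_def g_Suc by (simp add: sum_subtractf)
    finally show ?thesis
      using sum_lessThan_telescope[of "\<lambda>k. g k x" N] by (simp add: g_0)
  qed
  show ?thesis
  proof (cases "\<exists>n\<ge>1. \<forall>x\<in>\<Omega>. g n x \<le> 1")
    case True
    then obtain n where n: "1 \<le> n" "\<And>x. x \<in> \<Omega> \<Longrightarrow> g n x \<le> 1"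
      by blast
    have "1 \<le> u n x \<and> L (u n) x \<le> b x * u n x" if x: "x \<in> \<Omega>" for x
    proof
      have "g 0 x \<le> u n x"
        unfolding u_def using n(1) g_nonneg[OF x] by (intro member_le_sum) auto
      then show "1 \<le> u n x"
        by (simp add: g_0)
      have "T (u n) x \<le> u n x"
        using T_u[OF x] n(2)[OF x] by simp
      then have "b x * T (u n) x \<le> b x * u n x"
        using weight_pos[OF x] by simp
      then show "L (u n) x \<le> b x * u n x"
        by (simp add: T_eq[OF x])
    qed
    then show ?thesis
      using u_uc[of n] by (intro disjI1 exI[of _ "u n"]) blast
  next
    case False
    \<comment> \<open>Some point has \<open>g (Suc k) > 1\<close>, so \<open>L (g k)\<close> exceeds
      \<open>d\<close> there; as \<open>L\<close> is bounded by \<open>C\<close> times mass,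
      \<open>g k\<close> cannot have small mass.\<close>
    have g_mass: "d / C \<le> (\<integral>x. g k x \<partial>M)" for k
    proof -
      obtain x where x: "x \<in> \<Omega>" "1 < g (Suc k) x"
        using False by (metis le_add1 not_le plus_1_eq_Suc)
      have "d \<le> d * g (Suc k) x"
        using x(2) weight_bound_pos by simp
      also have "\<dots> \<le> b x * g (Suc k) x"
        using weight_ge[OF x(1)] x(2) by (intro mult_right_mono) auto
      also have "\<dots> = L (g k) x"
        unfolding g_Suc by (rule T_eq[OF x(1)])
      also have "\<dots> \<le> C * (\<integral>y. \<bar>g k y\<bar> \<partial>M)"
        using nlop_abs_le[OF x(1) g_int, of k] by simp
      also have "(\<integral>y. \<bar>g k y\<bar> \<partial>M) = (\<integral>y. g k y \<partial>M)"
        using g_nonneg by (intro Bochner_Integration.integral_cong) auto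
      finally show ?thesis
        using bound_pos by (simp add: divide_le_eq mult.commute)
    qed
    have u_mass: "real N * (d / C) \<le> (\<integral>x. u N x \<partial>M)" for N
    proof -
      have "real N * (d / C) = (\<Sum>k<N. d / C)"
        by simp
      also have "\<dots> \<le> (\<Sum>k<N. \<integral>x. g k x \<partial>M)"
        by (intro sum_mono g_mass)
      also have "\<dots> = (\<integral>x. u N x \<partial>M)"
        unfolding u_def using g_int by (simp add: Bochner_Integration.integral_sum)
      finally show ?thesis .
    qed
    obtain n \<kappa> where \<kappa>: "0 < \<kappa>" and irr: "\<And>v x. uniformly_continuous_on \<Omega> v \<Longrightarrow>
        \<forall>x\<in>\<Omega>. 0 \<le> v x \<Longrightarrow> x \<in> \<Omega> \<Longrightarrow> \<kappa> * (\<integral>y. v y \<partial>M) \<le> (T ^^ n) v x"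
      using T_funpow_irreducible by blast
    obtain G where G: "0 < G" "\<forall>x\<in>\<Omega>. \<bar>g n x\<bar> \<le> G"
      using uniformly_continuous_bounded[OF g_uc[of n]] by blast
    \<comment> \<open>\<open>N\<close> is taken so large that the error bound \<open>G\<close> falls
      below \<open>e / B\<close> times the lower bound \<open>m\<close> of \<open>w\<close>; the
      divisor \<open>B\<close> compensates the later multiplication by \<open>b\<close>.\<close>
    have "0 < e / B * (\<kappa> * (d / C))"
      using e weight_upper_pos \<kappa> weight_bound_pos bound_pos by simp
    then obtain N where "G < real N * (e / B * (\<kappa> * (d / C)))"
      using reals_Archimedean3 by metis
    then have N: "G < e / B * (\<kappa> * (real N * (d / C)))"
      by (simp add: mult_ac)
    define m where "m = \<kappa> * (real N * (d / C))"
    define w where "w = (T ^^ n) (u N)"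
    have Gm: "G < e / B * m"
      using N unfolding m_def .
    have "0 < m"
      using Gm G(1) e weight_upper_pos by (smt (verit) divide_pos_pos mult_nonneg_nonpos)
    moreover have "uniformly_continuous_on \<Omega> w"
      unfolding w_def using u_uc by (rule T_funpow_uniformly_continuous)
    moreover have w_ge: "m \<le> w x" if "x \<in> \<Omega>" for x
    proof -
      have "m \<le> \<kappa> * (\<integral>y. u N y \<partial>M)"
        unfolding m_def using \<kappa> by (intro mult_left_mono u_mass) simp
      also have "\<dots> \<le> w x"
        unfolding w_def using u_uc u_nonneg that by (intro irr) auto
      finally show ?thesis .
    qed
    moreover have "(b x - e) * w x \<le> L w x" if x: "x \<in> \<Omega>" for x
    proof -
      \<comment> \<open>Apply the \<open>n\<close>-th power of \<open>T\<close> to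
        \<open>u N - 1 \<le> T (u N)\<close>, where the nonnegative \<open>g N\<close> was dropped.
        The only error is \<open>g n\<close>, which is independent of \<open>N\<close>.\<close>
      have "w x - g n x = (T ^^ n) (\<lambda>y. u N y - 1) x"
        unfolding w_def g_def
        using T_funpow_diff[OF u_uc uniformly_continuous_on_const x] by simp
      also have "\<dots> \<le> (T ^^ n) (T (u N)) x"
      proof (rule T_funpow_mono[OF _ _ _ x])
        show "uniformly_continuous_on \<Omega> (\<lambda>y. u N y - 1)"
          using u_uc by (intro uniformly_continuous_on_diff uniformly_continuous_on_const)
        show "uniformly_continuous_on \<Omega> (T (u N))"
          using u_uc by (intro T_uniformly_continuous uniformly_continuous_integrable)
        show "u N y - 1 \<le> T (u N) y" if "y \<in> \<Omega>" for y
          using T_u[OF that] g_nonneg[OF that] by simp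
      qed
      also have "\<dots> = T w x"
        unfolding w_def by (simp add: funpow_swap1)
      finally have "w x - g n x \<le> T w x" .
      moreover have "g n x \<le> e / B * w x"
      proof -
        have "g n x \<le> G"
          using G(2) x by fastforce
        also have "G \<le> e / B * m"
          using Gm by simp
        also have "\<dots> \<le> e / B * w x"
          using w_ge[OF x] e weight_upper_pos by (intro mult_left_mono) auto
        finally show ?thesis .
      qed
      ultimately have "b x * (w x - e / B * w x) \<le> b x * T w x"
        using weight_pos[OF x] by simp
      moreover have "b x * (e / B * w x) \<le> e * w x"
      proof -
        have "b x / B * (e * w x) \<le> 1 * (e * w x)"
          using weight_le[OF x] weight_upper_pos e w_ge[OF x] \<open>0 < m\<close>
          by (intro mult_right_mono) auto
        then show ?thesis by simp
      qed
      ultimately show ?thesis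
        unfolding T_eq[OF x] by (simp add: algebra_simps)
    qed
    ultimately show ?thesis
      by (intro disjI2 exI[of _ w] exI[of _ m]) blast
  qed
qed

end

section \<open>Generalized principal eigenvalues\<close>

context irreducible_kernel
begin

section \<open>The admissible parameter sets behind the four numbers\<close>

definition super_values :: "('a \<Rightarrow> real) \<Rightarrow> real set" where
  "super_values a = {l. \<exists>\<phi>. continuous_on (closure \<Omega>) \<phi> \<and> (\<forall>x\<in>closure \<Omega>. \<phi> x > 0) \<and>
      (\<forall>x\<in>\<Omega>. L \<phi> x + a x * \<phi> x + l * \<phi> x \<le> 0)}"

definition sub_values :: "('a \<Rightarrow> real) \<Rightarrow> real set" where
  "sub_values a = {l. \<exists>\<phi>. continuous_on \<Omega> \<phi> \<and> bounded (\<phi> ` \<Omega>) \<and>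
      (\<forall>x\<in>\<Omega>. \<phi> x \<ge> 0) \<and> (\<exists>x\<in>\<Omega>. \<phi> x \<noteq> 0) \<and>
      (\<forall>x\<in>\<Omega>. L \<phi> x + (a x + l) * \<phi> x \<ge> 0)}"

definition compact_sub_values :: "('a \<Rightarrow> real) \<Rightarrow> real set" where
  "compact_sub_values a = {l. \<exists>\<phi> S. continuous_on \<Omega> \<phi> \<and> compact S \<and> S \<subseteq> \<Omega> \<and>
      (\<forall>x\<in>\<Omega> - S. \<phi> x = 0) \<and>
      (\<forall>x\<in>\<Omega>. \<phi> x \<ge> 0) \<and> (\<exists>x\<in>\<Omega>. \<phi> x \<noteq> 0) \<and>
      (\<forall>x\<in>\<Omega>. L \<phi> x + (a x + l) * \<phi> x \<ge> 0)}"

definition rayleigh_values :: "('a \<Rightarrow> real) \<Rightarrow> real set" where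
  "rayleigh_values a = {q. \<exists>\<phi>. \<phi> \<in> borel_measurable M \<and>
      integrable M (\<lambda>x. (\<phi> x)\<^sup>2) \<and> integral\<^sup>L M (\<lambda>x. (\<phi> x)\<^sup>2) \<noteq> 0 \<and>
      q = - integral\<^sup>L M (\<lambda>x. (L \<phi> x + a x * \<phi> x) * \<phi> x) / integral\<^sup>L M (\<lambda>x. (\<phi> x)\<^sup>2)}"

lemma lambda_eqs:
  "lambda_p K \<Omega> a = Sup (super_values a)"
  "lambda_p' K \<Omega> a = Inf (sub_values a)"
  "lambda_p'' K \<Omega> a = Inf (compact_sub_values a)"
  "lambda_v K \<Omega> a = Inf (rayleigh_values a)"
  unfolding lambda_p_def lambda_p'_def lambda_p''_def lambda_v_def
    super_values_def sub_values_def compact_sub_values_def rayleigh_values_def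
  by (rule refl)+

lemma compact_support_bounded:
  fixes f :: "'a \<Rightarrow> real"
  assumes "continuous_on \<Omega> f" "compact S" "S \<subseteq> \<Omega>" "\<forall>x\<in>\<Omega> - S. f x = 0"
  shows "bounded (f ` \<Omega>)"
proof -
  have "continuous_on S f"
    using assms(1,3) by (rule continuous_on_subset)
  then have "bounded (f ` S)"
    using assms(2) by (intro compact_imp_bounded compact_continuous_image)
  moreover have "f ` \<Omega> \<subseteq> insert 0 (f ` S)"
    using assms(4) by blast
  ultimately show ?thesis
    by (meson bounded_insert bounded_subset)
qed

lemma compact_sub_values_subset: "compact_sub_values a \<subseteq> sub_values a"
proof
  fix l assume "l \<in> compact_sub_values a"
  then obtain f S where f: "continuous_on \<Omega> f" "compact S" "S \<subseteq> \<Omega>" "\<forall>x\<in>\<Omega> - S. f x = 0"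
      "\<forall>x\<in>\<Omega>. f x \<ge> 0" "\<exists>x\<in>\<Omega>. f x \<noteq> 0" "\<forall>x\<in>\<Omega>. L f x + (a x + l) * f x \<ge> 0"
    unfolding compact_sub_values_def by blast
  then show "l \<in> sub_values a"
    unfolding sub_values_def using compact_support_bounded[OF f(1-4)] by blast
qed

lemma super_values_le_sub_values:
  assumes "uniformly_continuous_on \<Omega> a" "l \<in> super_values a" "m \<in> sub_values a"
  shows "l \<le> m"
  using assms(2,3) supersolution_le_subsolution[OF assms(1)]
  unfolding super_values_def sub_values_def mem_Collect_eq by metis

text \<open>The substitute for an eigenvalue: it leaves no room for a gap of positive length between
  the supersolution parameters and the compactly supported subsolution parameters.\<close>

lemma super_values_dichotomy:
  assumes a: "uniformly_continuous_on \<Omega> a" and e: "0 < e"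
  shows "l \<in> super_values a \<or> l + e \<in> compact_sub_values a"
proof (cases "\<exists>x\<in>\<Omega>. 0 < a x + l + e")
  case True
  define U where "U = \<Omega> \<inter> (\<lambda>x. a x + (l + e)) -` {0<..}"
  have "continuous_on \<Omega> (\<lambda>x. a x + (l + e))"
    using uniformly_continuous_imp_continuous[OF a]
    by (intro continuous_on_add continuous_on_const)
  then have "open U"
    unfolding U_def using open_dom open_greaterThan by (rule continuous_open_preimage)
  moreover obtain x0 where x0: "x0 \<in> U"
    using True unfolding U_def by (auto simp: add.assoc)
  ultimately obtain \<rho> where \<rho>: "0 < \<rho>" "cball x0 \<rho> \<subseteq> U"
    by (meson open_contains_cball)
  \<comment> \<open>On the ball the zero-order coefficient is positive, outside it \<open>f\<close>
    vanishes, and \<open>L f \<ge> 0\<close> everywhere.\<close>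
  define f where "f x = max 0 (\<rho> - dist x x0)" for x
  have f_nonneg: "0 \<le> f x" for x
    unfolding f_def by simp
  have f_0: "f x = 0" if "x \<notin> cball x0 \<rho>" for x
    using that unfolding f_def by (simp add: dist_commute)
  have "continuous_on \<Omega> f"
    unfolding f_def
    by (intro continuous_on_max continuous_on_diff continuous_on_dist continuous_on_const continuous_on_id)
  moreover have "cball x0 \<rho> \<subseteq> \<Omega>"
    using \<rho>(2) unfolding U_def by blast
  moreover have "\<exists>x\<in>\<Omega>. f x \<noteq> 0"
    using x0 \<rho>(1) unfolding U_def f_def by (intro bexI[of _ x0]) auto
  moreover have "0 \<le> L f x + (a x + (l + e)) * f x" if x: "x \<in> \<Omega>" for x
  proof (cases "x \<in> cball x0 \<rho>")
    case True
    then have "0 < a x + (l + e)"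
      using \<rho>(2) unfolding U_def by blast
    then show ?thesis
      using nlop_nonneg[OF x, of f] f_nonneg by simp
  next
    case False
    then show ?thesis
      using nlop_nonneg[OF x, of f] f_nonneg f_0 by simp
  qed
  ultimately have "l + e \<in> compact_sub_values a"
    unfolding compact_sub_values_def mem_Collect_eq
    using f_nonneg f_0 compact_cball[of x0 \<rho>]
    by (intro exI[of _ f] exI[of _ "cball x0 \<rho>"]) simp
  then show ?thesis ..
next
  case False
  define b where "b x = - a x - l" for x
  have b_uc: "uniformly_continuous_on \<Omega> b"
    unfolding b_def using a
    by (intro uniformly_continuous_on_diff uniformly_continuous_on_minus uniformly_continuous_on_const)
  obtain B where B: "\<forall>x\<in>\<Omega>. \<bar>b x\<bar> \<le> B"
    using uniformly_continuous_bounded[OF b_uc] by blast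
  have b_ge: "e \<le> b x" if "x \<in> \<Omega>" for x
    using False that unfolding b_def by force
  interpret weighted_kernel \<Omega> K C r c b e B
    by unfold_locales (use b_uc b_ge e B in \<open>auto simp: abs_le_iff\<close>)
  \<comment> \<open>The gap \<open>e\<close> is spent in halves: one on the approximate subsolution,
    one on its cut-off.\<close>
  from exists_supersolution_or_subsolution[of "e / 2"] e
  consider u where "uniformly_continuous_on \<Omega> u" "\<forall>x\<in>\<Omega>. 1 \<le> u x \<and> L u x \<le> b x * u x"
    | w m where "uniformly_continuous_on \<Omega> w" "0 < m"
      "\<forall>x\<in>\<Omega>. m \<le> w x \<and> (b x - e / 2) * w x \<le> L w x"
    by auto
  then show ?thesis
  proof cases
    case 1
    then obtain g where g: "continuous_on (closure \<Omega>) g" "\<forall>x\<in>\<Omega>. g x = u x"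
      using uniformly_continuous_iff_extension by blast
    have "1 \<le> g x" if "x \<in> closure \<Omega>" for x
      using continuous_ge_on_closure[OF g(1) that] g(2) 1(2) by simp
    then have g_pos: "\<forall>x\<in>closure \<Omega>. 0 < g x"
      by fastforce
    have "L g x + a x * g x + l * g x \<le> 0" if x: "x \<in> \<Omega>" for x
    proof -
      have "L g x = L u x"
        using g(2) by (intro nlop_cong) auto
      then show ?thesis
        using 1(2) g(2) x unfolding b_def by (force simp: algebra_simps)
    qed
    then have "l \<in> super_values a"
      unfolding super_values_def using g(1) g_pos by blast
    then show ?thesis ..
  next
    case 2
    obtain f S where f: "continuous_on \<Omega> f" "compact S" "S \<subseteq> \<Omega>" "\<forall>x\<in>\<Omega> - S. f x = 0"
        "\<forall>x\<in>\<Omega>. 0 \<le> f x" "\<exists>x\<in>\<Omega>. f x \<noteq> 0"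
        "\<forall>x\<in>\<Omega>. (b x - e / 2 - e / 2) * f x \<le> L f x"
      using exists_compactly_supported_subsolution[OF 2(1,2), of "\<lambda>x. b x - e / 2" "e / 2"] 2(3) e
      by auto
    have "0 \<le> L f x + (a x + (l + e)) * f x" if "x \<in> \<Omega>" for x
    proof -
      have "b x - e / 2 - e / 2 = - (a x + (l + e))"
        unfolding b_def by simp
      then have "- (a x + (l + e)) * f x \<le> L f x"
        using f(7) that by metis
      then show ?thesis
        by (simp add: algebra_simps)
    qed
    then have "l + e \<in> compact_sub_values a"
      unfolding compact_sub_values_def using f(1-6) by blast
    then show ?thesis ..
  qed
qed

text \<open>\<open>Sup\<close> of an empty set of reals carries no information. The constant 1 is a
  supersolution for a very negative parameter, since \<open>L 1\<close> and \<open>a\<close> are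
  bounded.\<close>

lemma super_values_nonempty:
  assumes a: "uniformly_continuous_on \<Omega> a"
  shows "super_values a \<noteq> {}"
proof -
  obtain A where A: "\<forall>x\<in>\<Omega>. \<bar>a x\<bar> \<le> A"
    using uniformly_continuous_bounded[OF a] by blast
  define I where "I = C * (\<integral>y. \<bar>1\<bar> \<partial>M)"
  have "L (\<lambda>_. 1) x + a x * 1 + (- A - I) * 1 \<le> 0" if "x \<in> \<Omega>" for x
  proof -
    have "\<bar>L (\<lambda>_. 1) x\<bar> \<le> I"
      unfolding I_def using that by (intro nlop_abs_le) auto
    then show ?thesis
      using A that by fastforce
  qed
  then have "- A - I \<in> super_values a"
    unfolding super_values_def mem_Collect_eq
    by (intro exI[of _ "\<lambda>_. 1"]) (simp add: continuous_on_const)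
  then show ?thesis by blast
qed

text \<open>A supersolution with parameter \<open>1 - a x0\<close> would give
  \<open>L g + g \<le> 0\<close> at \<open>x0\<close>, which positivity of \<open>g\<close> forbids;
  the dichotomy then supplies a subsolution parameter.\<close>

lemma compact_sub_values_nonempty:
  assumes a: "uniformly_continuous_on \<Omega> a"
  shows "compact_sub_values a \<noteq> {}"
proof -
  obtain x0 where x0: "x0 \<in> \<Omega>"
    using nonempty_dom by blast
  have "1 - a x0 \<notin> super_values a"
  proof
    assume "1 - a x0 \<in> super_values a"
    then obtain g where g: "\<forall>x\<in>closure \<Omega>. 0 < g x"
        "L g x0 + a x0 * g x0 + (1 - a x0) * g x0 \<le> 0"
      unfolding super_values_def using x0 by blast
    have g_pos: "0 < g x" if "x \<in> \<Omega>" for x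
      using that g(1) closure_subset by blast
    then have "0 \<le> L g x0"
      by (intro nlop_nonneg[OF x0]) (simp add: less_imp_le)
    with g(2) g_pos[OF x0] show False
      by (simp add: algebra_simps)
  qed
  then show ?thesis
    using super_values_dichotomy[OF a, of 1 "1 - a x0"] by auto
qed

text \<open>Keeping \<open>V\<close> abstract lets one argument serve all three infima:
  \<open>V\<close> must lie above the supersolution parameters and reach at least as low as the
  compactly supported subsolution parameters.\<close>

lemma Sup_super_values_eq:
  assumes a: "uniformly_continuous_on \<Omega> a"
    and V: "V \<noteq> {}" "\<And>l v. l \<in> super_values a \<Longrightarrow> v \<in> V \<Longrightarrow> l \<le> v"
      "\<And>m. m \<in> compact_sub_values a \<Longrightarrow> \<exists>v\<in>V. v \<le> m"
  shows "Sup (super_values a) = Inf V"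
proof (rule antisym)
  obtain v where v: "v \<in> V"
    using V(1) by blast
  have S_bdd: "bdd_above (super_values a)"
    using V(2)[OF _ v] by (rule bdd_aboveI)
  obtain l where l: "l \<in> super_values a"
    using super_values_nonempty[OF a] by blast
  have V_bdd: "bdd_below V"
    using V(2)[OF l] by (rule bdd_belowI)
  show "Sup (super_values a) \<le> Inf V"
    using super_values_nonempty[OF a] V(1,2) by (intro cSup_least cInf_greatest)
  show "Inf V \<le> Sup (super_values a)"
  proof (rule field_le_epsilon)
    fix e :: real assume e: "0 < e"
    \<comment> \<open>Half of \<open>e\<close> steps strictly above the supremum, the other half is
      the slack of the dichotomy.\<close>
    have "Sup (super_values a) + e / 2 \<notin> super_values a"
      using cSup_upper[OF _ S_bdd, of "Sup (super_values a) + e / 2"] e by fastforce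
    then have "Sup (super_values a) + e / 2 + e / 2 \<in> compact_sub_values a"
      using super_values_dichotomy[OF a, of "e / 2" "Sup (super_values a) + e / 2"] e by simp
    then obtain v where "v \<in> V" "v \<le> Sup (super_values a) + e / 2 + e / 2"
      using V(3) by blast
    then show "Inf V \<le> Sup (super_values a) + e"
      using cInf_lower[OF _ V_bdd, of v] by simp
  qed
qed

section \<open>Rayleigh quotients\<close>

lemma super_values_le_rayleigh_values:
  assumes sym: "\<And>x y. x \<in> \<Omega> \<Longrightarrow> y \<in> \<Omega> \<Longrightarrow> K x y = K y x"
    and a: "uniformly_continuous_on \<Omega> a" and l: "l \<in> super_values a" and q: "q \<in> rayleigh_values a"
  shows "l \<le> q"
proof -
  obtain g where g: "continuous_on (closure \<Omega>) g" "\<forall>x\<in>closure \<Omega>. 0 < g x"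
      "\<forall>x\<in>\<Omega>. L g x + a x * g x + l * g x \<le> 0"
    using l unfolding super_values_def by blast
  obtain f where f: "f \<in> borel_measurable M" "integrable M (\<lambda>x. (f x)\<^sup>2)"
      "(\<integral>x. (f x)\<^sup>2 \<partial>M) \<noteq> 0"
      "q = - (\<integral>x. (L f x + a x * f x) * f x \<partial>M) / (\<integral>x. (f x)\<^sup>2 \<partial>M)"
    using q unfolding rayleigh_values_def by blast
  have "0 \<le> (\<integral>x. (f x)\<^sup>2 \<partial>M)"
    by simp
  then have pos: "0 < (\<integral>x. (f x)\<^sup>2 \<partial>M)"
    using f(3) by (simp only: less_le not_sym simp_thms)
  have "l * (\<integral>x. (f x)\<^sup>2 \<partial>M) \<le> - (\<integral>x. (L f x + a x * f x) * f x \<partial>M)"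
    using quadratic_form_le[OF sym a g f(1,2)] by simp
  then show ?thesis
    unfolding f(4) pos_le_divide_eq[OF pos] .
qed

text \<open>The subsolution itself is the test function: multiplying its inequality by
  \<open>f \<ge> 0\<close> and integrating bounds its quotient by \<open>m\<close>.\<close>

lemma exists_rayleigh_value_le:
  assumes a: "uniformly_continuous_on \<Omega> a" and m: "m \<in> compact_sub_values a"
  shows "\<exists>q\<in>rayleigh_values a. q \<le> m"
proof -
  obtain f S where f: "continuous_on \<Omega> f" "compact S" "S \<subseteq> \<Omega>" "\<forall>x\<in>\<Omega> - S. f x = 0"
      "\<forall>x\<in>\<Omega>. f x \<ge> 0" "\<exists>x\<in>\<Omega>. f x \<noteq> 0" "\<forall>x\<in>\<Omega>. L f x + (a x + m) * f x \<ge> 0"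
    using m unfolding compact_sub_values_def by blast
  obtain F where F: "\<And>x. x \<in> \<Omega> \<Longrightarrow> \<bar>f x\<bar> \<le> F"
    using compact_support_bounded[OF f(1-4)] unfolding bounded_pos by auto
  have f_meas: "f \<in> borel_measurable M"
    using f(1) by (rule continuous_measurable)
  have f_int: "integrable M f"
    using f_meas F by (rule bounded_measurable_integrable)
  have ff_int: "integrable M (\<lambda>x. (f x)\<^sup>2)"
  proof (rule bounded_measurable_integrable)
    show "(\<lambda>x. (f x)\<^sup>2) \<in> borel_measurable M"
      using f_meas by simp
    show "\<bar>(f x)\<^sup>2\<bar> \<le> F\<^sup>2" if "x \<in> \<Omega>" for x
      using power_mono[OF F[OF that], of 2] by simp
  qed
  obtain x0 where x0: "x0 \<in> \<Omega>" "f x0 \<noteq> 0"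
    using f(6) by blast
  \<comment> \<open>A continuous function that is nonzero somewhere is nonzero on a nonempty open
    set, which is not negligible.\<close>
  have ff_pos: "0 < (\<integral>x. (f x)\<^sup>2 \<partial>M)"
  proof -
    define U where "U = \<Omega> \<inter> f -` (- {0})"
    have "open U"
      unfolding U_def using f(1) open_dom by (rule continuous_open_preimage) auto
    then have "\<not> negligible U"
      using open_not_negligible x0 unfolding U_def by blast
    moreover have "negligible U" if "(\<integral>x. (f x)\<^sup>2 \<partial>M) = 0"
    proof -
      have "AE x in M. (f x)\<^sup>2 = 0"
        using integral_nonneg_eq_0_iff_AE[OF ff_int] that by simp
      then obtain N where N: "{x \<in> space M. (f x)\<^sup>2 \<noteq> 0} \<subseteq> N" "emeasure M N = 0" "N \<in> sets M"
        by (rule AE_E)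
      have "N \<subseteq> \<Omega>"
        using N(3) sets.sets_into_space by fastforce
      then have "N \<in> null_sets lebesgue"
        using N(2,3) by (simp add: null_sets_def emeasure_restrict_space sets_restrict_space_iff)
      then have "negligible N"
        by (simp add: negligible_iff_null_sets)
      then show ?thesis
        using N(1) unfolding U_def by (auto intro: negligible_subset)
    qed
    ultimately have "(\<integral>x. (f x)\<^sup>2 \<partial>M) \<noteq> 0"
      by blast
    moreover have "0 \<le> (\<integral>x. (f x)\<^sup>2 \<partial>M)"
      by simp
    ultimately show ?thesis
      by (simp only: less_le not_sym simp_thms)
  qed
  define q where "q = - (\<integral>x. (L f x + a x * f x) * f x \<partial>M) / (\<integral>x. (f x)\<^sup>2 \<partial>M)"
  have Lf_f: "integrable M (\<lambda>x. L f x * f x)"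
    using f_int nlop_uniformly_continuous[OF f_int] by (rule integrable_mult_uniformly_continuous)
  have a_ff: "integrable M (\<lambda>x. a x * (f x)\<^sup>2)"
    using ff_int a by (rule integrable_mult_uniformly_continuous)
  have "integrable M (\<lambda>x. L f x * f x + a x * (f x)\<^sup>2)"
    using Lf_f a_ff by simp
  then have int: "integrable M (\<lambda>x. (L f x + a x * f x) * f x)"
    by (simp add: distrib_right power2_eq_square mult.assoc)
  have "(\<integral>x. - m * (f x)\<^sup>2 \<partial>M) \<le> (\<integral>x. (L f x + a x * f x) * f x \<partial>M)"
  proof (rule integral_mono)
    fix x assume "x \<in> space M"
    then have x: "x \<in> \<Omega>" by simp
    then have "0 \<le> (L f x + (a x + m) * f x) * f x"
      using f(5,7) by simp
    then show "- m * (f x)\<^sup>2 \<le> (L f x + a x * f x) * f x"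
      by (simp add: algebra_simps power2_eq_square)
  qed (use ff_int int in auto)
  then have "- (\<integral>x. (L f x + a x * f x) * f x \<partial>M) \<le> m * (\<integral>x. (f x)\<^sup>2 \<partial>M)"
    by simp
  then have "q \<le> m"
    unfolding q_def pos_divide_le_eq[OF ff_pos] .
  moreover have "q \<in> rayleigh_values a"
    unfolding rayleigh_values_def q_def mem_Collect_eq
    by (intro exI[of _ f] conjI f_meas ff_int refl) (rule less_imp_neq[OF ff_pos, symmetric])
  ultimately show ?thesis
    by blast
qed

end

theorem theorem1p1:
  fixes \<Omega> :: "'a::euclidean_space set"
    and K :: "'a \<Rightarrow> 'a \<Rightarrow> real"
    and a :: "'a \<Rightarrow> real"
    and r0 r1 C0 c0 :: real
  assumes "open \<Omega>" and "connected \<Omega>" and "\<Omega> \<noteq> {}" and "bounded \<Omega>"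
    and "continuous_on (closure \<Omega>) a" and "bounded (a ` \<Omega>)"
    and "\<forall>x\<in>\<Omega>. \<forall>y\<in>\<Omega>. K x y \<ge> 0"
    and "\<forall>x\<in>\<Omega>. K x \<in> borel_measurable (lebesgue_on \<Omega>)"
    and "AE y in lebesgue_on \<Omega>. uniformly_continuous_on \<Omega> (\<lambda>x. K x y)"
    and "r0 \<ge> r1" and "r1 > 0" and "C0 \<ge> c0" and "c0 > 0"
    and "\<forall>x\<in>\<Omega>. \<forall>y\<in>\<Omega>. C0 * indicator (\<Omega> \<inter> ball x r0) y \<ge> K x y
                        \<and> K x y \<ge> c0 * indicator (\<Omega> \<inter> ball x r1) y"
  shows "lambda_p K \<Omega> a = lambda_p' K \<Omega> a \<and> lambda_p' K \<Omega> a = lambda_p'' K \<Omega> a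
         \<and> ((\<forall>x\<in>\<Omega>. \<forall>y\<in>\<Omega>. K x y = K y x) \<longrightarrow> lambda_p K \<Omega> a = lambda_v K \<Omega> a)"
proof -
  have C0: "0 < C0"
    using assms(12,13) by simp
  have K_le: "K x y \<le> C0" if "x \<in> \<Omega>" "y \<in> \<Omega>" for x y
  proof -
    have "K x y \<le> C0 * indicator (\<Omega> \<inter> ball x r0) y"
      using assms(14) that by blast
    also have "\<dots> \<le> C0"
      using C0 by (simp add: indicator_def)
    finally show ?thesis .
  qed
  have K_ge: "c0 \<le> K x y" if "x \<in> \<Omega>" "y \<in> \<Omega>" "dist x y < r1" for x y
  proof -
    have "c0 * indicator (\<Omega> \<inter> ball x r1) y \<le> K x y"
      using assms(14) that by blast
    then show ?thesis
      using that by simp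
  qed
  interpret irreducible_kernel \<Omega> K C0 r1 c0
    by unfold_locales (use assms(1-4,7-9,11,13) C0 K_le K_ge in auto)
  have a: "uniformly_continuous_on \<Omega> a"
    using assms(5) uniformly_continuous_iff_extension by blast
  have compact_ne: "compact_sub_values a \<noteq> {}"
    using a by (rule compact_sub_values_nonempty)
  \<comment> \<open>Both sets of subsolution parameters contain the compactly supported ones, so
    each such parameter is its own witness; the Rayleigh values need the test-function argument
    instead.\<close>
  have "Sup (super_values a) = Inf (sub_values a)"
    using compact_sub_values_subset compact_ne
    by (intro Sup_super_values_eq[OF a] super_values_le_sub_values[OF a]) blast+
  moreover have "Sup (super_values a) = Inf (compact_sub_values a)"
    using compact_sub_values_subset compact_ne
    by (intro Sup_super_values_eq[OF a] super_values_le_sub_values[OF a]) blast+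
  moreover have "Sup (super_values a) = Inf (rayleigh_values a)" if "\<forall>x\<in>\<Omega>. \<forall>y\<in>\<Omega>. K x y = K y x"
    using that compact_ne exists_rayleigh_value_le[OF a]
    by (intro Sup_super_values_eq[OF a] super_values_le_rayleigh_values[OF _ a]) blast+
  ultimately show ?thesis
    unfolding lambda_eqs by simp
qed

end
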